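(* Let $\phi$ be a Ma-Minda function such that $\min_{|z|=r}|\phi(z)|=\phi(-r)$ and $\max_{|z|=r}|\phi(z)|=\phi(r)$ for all $0<r<1$. Let $h$ be the analytic function in $\mathbb{D}$ with $zh'(z)/h(z)=\phi(z)$, $h(0)=h'(0)-1=0$, and put $$P(r):=\int_0^r\frac{M_h(t)M_\phi(t)}{t}\,dt ,$$ where $M_h$ and $M_\phi$ are the majorant series of $h$ and $\phi$. Let $f(z)=z+\sum_{n=2}^\infty a_nz^n\in\mathcal{S}^*_c(\phi)$. Then $$|z|+\sum_{n=2}^\infty|a_n||z|^n\le d(f(0),\partial f(\mathbb{D}))$$ for $|z|=r\le\min\{1/3,r_f\}$, where $r_f$ is the smallest positive root of $P(r)+h(-1)=0$ in $(0,1)$.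
   Context: $\mathbb{D}=\{z\in\mathbb{C}:|z|<1\}$ and $\mathcal{A}$ is the class of analytic functions $f$ in $\mathbb{D}$ of the form $f(z)=z+\sum_{n\ge2}a_nz^n$. $d$ is Euclidean distance, $d(f(0),\partial f(\mathbb{D}))$ being the distance from $f(0)$ to the boundary of $f(\mathbb{D})$. For $f(z)=\sum_{n\ge0}a_nz^n$ analytic in $\mathbb{D}$, the majorant series is $M_f(r)=\sum_{n\ge0}|a_n|r^n$, $0\le r<1$. For analytic $f,g$ in $\mathbb{D}$, $f\prec g$ means $f=g\circ\omega$ for some analytic $\omega:\mathbb{D}\to\mathbb{D}$ with $\omega(0)=0$. A Ma-Minda function is an analytic univalent function $\phi:\mathbb{D}\to\mathbb{C}$ such that $\phi(\mathbb{D})$ lies in the right half-plane $\{\mathrm{Re}\,w>0\}$, is symmetric with respect to the real axis and starlike with respect to $\phi(0)=1$, and $\phi'(0)>0$. $\mathcal{S}^*_c(\phi)$ (starlike functions with respect to conjugate points associated with $\phi$) is the class of $f\in\mathcal{A}$ with $\dfrac{2zf'(z)}{f(z)+\overline{f(\bar z)}}\prec\phi(z)$ in $\mathbb{D}$. The value $h(-1)$ denotes $\lim_{r\to1^-}h(-r)$. *)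

theory Defs
  imports "HOL-Complex_Analysis.Complex_Analysis"
begin

abbreviation unit_disc :: "complex set" where
  "unit_disc \<equiv> ball 0 1"

definition normalized_expansion :: "(complex \<Rightarrow> complex) \<Rightarrow> (nat \<Rightarrow> complex) \<Rightarrow> bool" where
  "normalized_expansion f a \<longleftrightarrow>
     (\<forall>z\<in>unit_disc. (\<lambda>n. a (n + 2) * z ^ (n + 2)) sums (f z - z))"

definition class_A :: "(complex \<Rightarrow> complex) set" where
  "class_A = {f. f holomorphic_on unit_disc \<and> (\<exists>a. normalized_expansion f a)}"

definition majorant :: "(complex \<Rightarrow> complex) \<Rightarrow> real \<Rightarrow> real" where
  "majorant f r = (\<Sum>n. cmod (fps_nth (fps_expansion f 0) n) * r ^ n)"

definition subordinate :: "(complex \<Rightarrow> complex) \<Rightarrow> (complex \<Rightarrow> complex) \<Rightarrow> bool" where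
  "subordinate f g \<longleftrightarrow>
     (\<exists>\<omega>. \<omega> holomorphic_on unit_disc \<and> \<omega> ` unit_disc \<subseteq> unit_disc \<and> \<omega> 0 = 0 \<and>
          (\<forall>z\<in>unit_disc. f z = g (\<omega> z)))"

definition ma_minda :: "(complex \<Rightarrow> complex) \<Rightarrow> bool" where
  "ma_minda \<phi> \<longleftrightarrow>
     \<phi> holomorphic_on unit_disc \<and> inj_on \<phi> unit_disc \<and>
     \<phi> ` unit_disc \<subseteq> {w. Re w > 0} \<and>
     cnj ` \<phi> ` unit_disc = \<phi> ` unit_disc \<and>
     (\<forall>w\<in>\<phi> ` unit_disc. closed_segment (\<phi> 0) w \<subseteq> \<phi> ` unit_disc) \<and>
     \<phi> 0 = 1 \<and>
     deriv \<phi> 0 \<in> \<real> \<and> Re (deriv \<phi> 0) > 0"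

text \<open>The quotient \<open>2zf'(z) / (f(z) + cnj (f (cnj z)))\<close> has a removable singularity at the
  origin; for \<open>f\<close> in \<open>class_A\<close> its limit there is 1.\<close>
definition conj_quotient :: "(complex \<Rightarrow> complex) \<Rightarrow> complex \<Rightarrow> complex" where
  "conj_quotient f z =
     (if z = 0 then 1 else 2 * z * deriv f z / (f z + cnj (f (cnj z))))"

text \<open>The nonvanishing condition states that the quotient is defined off the origin, since
  division by zero is total in HOL.\<close>
definition starlike_conj :: "(complex \<Rightarrow> complex) \<Rightarrow> (complex \<Rightarrow> complex) set" where
  "starlike_conj \<phi> = {f \<in> class_A.
     (\<forall>z\<in>unit_disc - {0}. f z + cnj (f (cnj z)) \<noteq> 0) \<and>
     subordinate (conj_quotient f) \<phi>}"

definition value_at_minus_one :: "(complex \<Rightarrow> complex) \<Rightarrow> complex" where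
  "value_at_minus_one h = Lim (at_left (1::real)) (\<lambda>r. h (- complex_of_real r))"

definition majorant_integral ::
  "(complex \<Rightarrow> complex) \<Rightarrow> (complex \<Rightarrow> complex) \<Rightarrow> real \<Rightarrow> real" where
  "majorant_integral h \<phi> r = integral {0..r} (\<lambda>t. majorant h t * majorant \<phi> t / t)"

definition smallest_positive_root :: "(real \<Rightarrow> complex) \<Rightarrow> real \<Rightarrow> bool" where
  "smallest_positive_root F s \<longleftrightarrow>
     0 < s \<and> s < 1 \<and> F s = 0 \<and> (\<forall>t. 0 < t \<and> t < s \<longrightarrow> F t \<noteq> 0)"

end

theory Submission
  imports Defs
begin

text \<open>
  Put \<open>k\<close> for the primitive with \<open>z k'(z) = \<phi>(z) - 1\<close> and \<open>k(0) = 0\<close>, so that \<open>h(z) = z exp(k(z))\<close>, and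
  write \<open>f*(z) = cnj (f (cnj z))\<close>, \<open>g = (f + f*)/2\<close>. For \<open>f\<close> in the class, \<open>z f' = g q\<close> with
  \<open>q = \<phi> \<circ> \<omega>\<close> for a Schwarz function \<open>\<omega>\<close>, and \<open>z g'/g = (q + q*)/2\<close>. Since \<open>\<phi>\<close> maps onto a domain that
  is only starlike, the mean \<open>(q + q*)/2\<close> need not be subordinate to \<open>\<phi>\<close>. Its integrated form is
  nevertheless under control: \<open>log (g/z)\<close> is the mean of two functions \<open>A\<close> with
  \<open>z A' = (z k') \<circ> (Schwarz function)\<close>, and convex combinations of such functions stay in the image of \<open>k\<close>,
  because \<open>z k'\<close> is starlike (\<open>convex_combination_in_image\<close>). Hence \<open>g(z) = z exp(k(w(z)))\<close> for a Schwarz function \<open>w\<close>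
  (\<open>starlike_conj_factorization\<close>), that is, \<open>g/z\<close> is subordinate to \<open>h/z\<close>. Both halves of the theorem
  rest on the identity \<open>f' = exp(k \<circ> w) (\<phi> \<circ> \<omega>)\<close>.

  Lower bound for the distance. The image under \<open>k\<close> of a disc of radius \<open>r\<close> is convex and symmetric, so its
  leftmost real part is \<open>k(-r)\<close>; together with the minimum modulus hypothesis this gives
  \<open>\<bar>f'(z)\<bar> \<ge> H'(\<bar>z\<bar>)\<close> for \<open>H(t) = -h(-t)\<close>. Following preimages along a ray then shows that the image of
  \<open>f\<close> contains the disc of radius \<open>L = lim H = -h(-1)\<close> (\<open>ball_subset_image\<close>). The image is not the whole
  plane, because \<open>f\<close> is close-to-convex and therefore univalent
  (\<open>injective_if_derivative_quotient_Re_pos\<close>); so its boundary is nonempty and at distance at least \<open>L\<close>.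

  Upper bound for the majorant. Bohr's inequality implies that subordination decreases majorant series up
  to the radius \<open>1/3\<close> (\<open>majorant_subordinate_le\<close>). Applied to both factors of \<open>z f' = g q\<close> it bounds the
  majorant of \<open>z f'\<close> by the product of those of \<open>h\<close> and \<open>\<phi>\<close>, and integration gives that of
  \<open>f\<close> at most \<open>P(r)\<close>.

  Finally \<open>P\<close> is strictly increasing from \<open>0\<close> and \<open>P(r) \<ge> r + \<bar>\<phi>'(0)\<bar> r\<^sup>2 / 2\<close>, which exceeds
  \<open>1 \<ge> L\<close> for \<open>r\<close> near \<open>1\<close>. So \<open>P(r) = L\<close> has exactly one root, and up to this root
  \<open>P(r) \<le> L\<close>.
\<close>


section \<open>Extremal points on a disc and injectivity\<close>

text \<open>A linear functional \<open>Re (cnj e * w)\<close> that is maximal at \<open>z1\<close> over the disc through \<open>z1\<close> is stationary in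
  the tangential direction and nondecreasing in the radial one. As \<open>z1 * p'\<close> is the derivative in
  the radial direction and \<open>\<i> * z1 * p'\<close> that in the tangential one, \<open>z1 * p'\<close> points along \<open>e\<close>.\<close>
lemma inner_maximum_on_disc_derivative:
  assumes d: "(p has_field_derivative p') (at z1)" and "e \<noteq> 0"
    and mx: "\<And>z. cmod z \<le> cmod z1 \<Longrightarrow> Re (cnj e * p z) \<le> Re (cnj e * p z1)"
  obtains m where "m \<ge> 0" "z1 * p' = of_real m * e"
proof -
  define v where "v = cnj e * (z1 * p')"
  have d0: "(p has_field_derivative p') (at (z1 * exp (\<i> * of_real 0)))" using d by simp
  have "((\<lambda>w. cnj e * p (z1 * exp (\<i> * w))) has_field_derivative \<i> * v) (at (of_real 0))"
    unfolding v_def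
    by (rule DERIV_cmult[OF DERIV_chain2[where f = p and g = "\<lambda>w. z1 * exp (\<i> * w)", OF d0], THEN DERIV_cong])
       (auto intro!: derivative_eq_intros)
  from has_vector_derivative_real_field[OF this, of UNIV]
  have "((\<lambda>t. Re (cnj e * p (z1 * cis t))) has_real_derivative Re (\<i> * v)) (at 0)"
    unfolding has_real_derivative_iff_has_vector_derivative cis_conv_exp
    by (rule bounded_linear.has_vector_derivative[OF bounded_linear_Re])
  from DERIV_local_max[OF this zero_less_one] have "Re (\<i> * v) = 0"
    using mx by (simp add: norm_mult)
  then have im: "Im v = 0" by simp
  have d1: "(p has_field_derivative p') (at (z1 * of_real 1))" using d by simp
  have "((\<lambda>w. cnj e * p (z1 * w)) has_field_derivative v) (at (of_real 1))"
    unfolding v_def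
    by (rule DERIV_cmult[OF DERIV_chain2[where f = p and g = "\<lambda>w. z1 * w", OF d1], THEN DERIV_cong])
       (auto intro!: derivative_eq_intros)
  from has_vector_derivative_real_field[OF this, of UNIV]
  have rd: "((\<lambda>t. Re (cnj e * p (z1 * of_real t))) has_real_derivative Re v) (at 1)"
    unfolding has_real_derivative_iff_has_vector_derivative
    by (rule bounded_linear.has_vector_derivative[OF bounded_linear_Re])
  have re: "Re v \<ge> 0"
  proof (rule ccontr)
    assume "\<not> Re v \<ge> 0"
    then obtain \<delta> where "\<delta> > 0" and
      \<delta>: "\<And>h. 0 < h \<Longrightarrow> h < \<delta> \<Longrightarrow>
        Re (cnj e * p (z1 * of_real (1::real))) < Re (cnj e * p (z1 * of_real (1 - h)))"
      using DERIV_neg_dec_left[OF rd] by auto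
    define h where "h = min (\<delta>/2) 1"
    have "0 < h" "h < \<delta>" "h \<le> 1" using \<open>\<delta> > 0\<close> by (auto simp: h_def min_def)
    moreover have "cmod (z1 * of_real (1 - h)) \<le> cmod z1"
      using \<open>0 < h\<close> \<open>h \<le> 1\<close> by (simp add: norm_mult mult_left_le del: of_real_diff)
    ultimately show False using \<delta>[of h] mx[of "z1 * of_real (1 - h)"] by simp
  qed
  have "v = of_real (Re v)" using im by (simp add: complex_eq_iff)
  then have "e * v = of_real (Re v) * e" by (metis mult.commute)
  then have "of_real ((cmod e)\<^sup>2) * (z1 * p') = of_real (Re v) * e"
    unfolding v_def by (simp only: complex_norm_square mult.assoc)
  then have "z1 * p' = of_real (Re v / (cmod e)\<^sup>2) * e"
    using \<open>e \<noteq> 0\<close> by (simp add: field_simps)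
  then show ?thesis using that[of "Re v / (cmod e)\<^sup>2"] re by simp
qed

lemma norm_maximum_on_disc_derivative:
  assumes d: "(p has_field_derivative p') (at z1)" and "p z1 \<noteq> 0"
    and mx: "\<And>z. cmod z \<le> cmod z1 \<Longrightarrow> cmod (p z) \<le> cmod (p z1)"
  obtains m where "m \<ge> 0" "z1 * p' = of_real m * p z1"
proof (rule inner_maximum_on_disc_derivative[OF d \<open>p z1 \<noteq> 0\<close>])
  fix z assume "cmod z \<le> cmod z1"
  have "Re (cnj (p z1) * p z) \<le> cmod (cnj (p z1) * p z)" by (rule complex_Re_le_cmod)
  also have "\<dots> \<le> cmod (p z1) * cmod (p z1)"
    using mx[OF \<open>cmod z \<le> cmod z1\<close>] by (simp add: norm_mult mult_left_mono)
  also have "\<dots> = Re (cnj (p z1) * p z1)"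
    by (metis Re_complex_of_real complex_norm_square mult.commute power2_eq_square)
  finally show "Re (cnj (p z1) * p z) \<le> Re (cnj (p z1) * p z1)" .
qed

text \<open>A local homeomorphism that is injective on a maximal disc can lose injectivity only through two
  points of the bounding circle: a coincidence between the circle and the open disc would, by the open
  mapping theorem, produce one inside, and injectivity on the compact closed disc persists on a
  slightly larger one.\<close>
lemma injective_if_injective_on_spheres:
  assumes hol: "F holomorphic_on ball 0 1" and nz: "\<And>z. z \<in> ball 0 1 \<Longrightarrow> deriv F z \<noteq> 0"
    and step: "\<And>\<rho>. 0 < \<rho> \<Longrightarrow> \<rho> < 1 \<Longrightarrow> inj_on F (ball 0 \<rho>) \<Longrightarrow>
            F ` sphere 0 \<rho> \<inter> F ` ball 0 \<rho> = {} \<Longrightarrow> inj_on F (sphere 0 \<rho>)"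
  shows "inj_on F (ball (0::complex) 1)"
proof -
  define S where "S = {\<rho>. 0 < \<rho> \<and> \<rho> \<le> 1 \<and> inj_on F (ball 0 \<rho>)}"
  have zero: "(0::complex) \<in> ball 0 1" by simp
  obtain r0 where r0: "r0 > 0" "ball 0 r0 \<subseteq> ball (0::complex) 1" "inj_on F (ball 0 r0)"
    by (rule has_complex_derivative_locally_injective[OF hol zero open_ball nz[OF zero]])
  then have r0S: "r0 \<in> S" using r0 by (auto simp: S_def ball_subset_ball_iff)
  have bdd: "bdd_above S" unfolding S_def by (rule bdd_aboveI[of _ 1]) auto
  define R where "R = Sup S"
  have R0: "0 < R" using r0S cSup_upper[OF r0S bdd] \<open>r0 > 0\<close> by (simp add: R_def)
  have R1: "R \<le> 1" unfolding R_def by (rule cSup_least) (use r0S in \<open>auto simp: S_def\<close>)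
  have injR: "inj_on F (ball 0 R)"
  proof (rule inj_onI)
    fix x y assume xy: "x \<in> ball 0 R" "y \<in> ball 0 R" "F x = F y"
    then have "max (cmod x) (cmod y) < Sup S" by (simp add: R_def)
    then obtain \<rho> where "\<rho> \<in> S" "max (cmod x) (cmod y) < \<rho>"
      using less_cSup_iff[OF _ bdd] r0S by blast
    then show "x = y" using xy(3) by (auto simp: S_def inj_on_def)
  qed
  have "R = 1"
  proof (rule ccontr)
    assume "R \<noteq> 1"
    with R1 have "R < 1" by simp
    \<comment> \<open>Points \<open>w\<close> of the open disc close to \<open>z2\<close> have values in the open set \<open>F ` N\<close> but lie outside \<open>N\<close>.\<close>
    have mixed: False if z1: "cmod z1 < R" and z2: "cmod z2 = R" and eq: "F z1 = F z2" for z1 z2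
    proof -
      define N where "N = ball z1 ((R - cmod z1)/2)"
      have NR: "N \<subseteq> ball 0 R"
      proof
        fix x assume "x \<in> N"
        then have "cmod (x - z1) < (R - cmod z1)/2" by (simp add: N_def dist_norm norm_minus_commute)
        moreover have "cmod x \<le> cmod (x - z1) + cmod z1" by (metis norm_triangle_sub add.commute)
        ultimately show "x \<in> ball 0 R" using z1 by (simp add: field_simps)
      qed
      have opN: "open (F ` N)"
      proof (rule open_mapping_thm3)
        show "F holomorphic_on N" by (rule holomorphic_on_subset[OF hol]) (use NR \<open>R < 1\<close> in auto)
        show "inj_on F N" using injR NR by (rule inj_on_subset)
      qed (simp add: N_def)
      have cF: "isCont F z2"
        using holomorphic_on_imp_differentiable_at[OF hol open_ball, of z2] z2 \<open>R < 1\<close>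
        by (simp add: field_differentiable_imp_continuous_at)
      have "F z2 \<in> F ` N" unfolding eq[symmetric] using z1 by (intro imageI) (simp add: N_def)
      have lim: "(\<lambda>n. z2 * of_real (1 - 1 / real (Suc n))) \<longlonglongrightarrow> z2"
        by (rule tendsto_eq_intros LIMSEQ_Suc[OF lim_1_over_n] | simp)+
      have "(\<lambda>n. F (z2 * of_real (1 - 1 / real (Suc n)))) \<longlonglongrightarrow> F z2"
        by (rule isCont_tendsto_compose[OF cF lim])
      then have ev1: "\<forall>\<^sub>F n in sequentially. F (z2 * of_real (1 - 1 / real (Suc n))) \<in> F ` N"
        using opN \<open>F z2 \<in> F ` N\<close> by (rule topological_tendstoD)
      have z2N: "z2 \<notin> cball z1 ((R - cmod z1)/2)"
      proof
        assume "z2 \<in> cball z1 ((R - cmod z1)/2)"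
        then have "cmod (z2 - z1) \<le> (R - cmod z1)/2" by (simp add: dist_norm norm_minus_commute)
        moreover have "cmod z2 \<le> cmod (z2 - z1) + cmod z1" by (metis norm_triangle_sub add.commute)
        ultimately show False using z1 z2 by (simp add: field_simps)
      qed
      from lim have ev2: "\<forall>\<^sub>F n in sequentially. z2 * of_real (1 - 1 / real (Suc n)) \<in> - cball z1 ((R - cmod z1)/2)"
        by (rule topological_tendstoD) (use z2N in auto)
      obtain n where n: "F (z2 * of_real (1 - 1 / real (Suc n))) \<in> F ` N"
        "z2 * of_real (1 - 1 / real (Suc n)) \<in> - cball z1 ((R - cmod z1)/2)"
        using eventually_happens[OF eventually_conj[OF ev1 ev2]] by auto
      define w where "w = z2 * of_real (1 - 1 / real (Suc n))"
      have "cmod w < R"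
        unfolding w_def norm_mult norm_of_real z2 using R0 by (simp add: field_simps abs_if)
      moreover obtain x where "x \<in> N" "F x = F w" using n(1) by (auto simp: w_def)
      ultimately have "x = w" using injR NR by (auto simp: inj_on_def)
      then show False using \<open>x \<in> N\<close> n(2) by (auto simp: w_def N_def)
    qed
    have disj: "F ` sphere 0 R \<inter> F ` ball 0 R = {}"
    proof (rule equals0I)
      fix p assume "p \<in> F ` sphere 0 R \<inter> F ` ball 0 R"
      then obtain z1 z2 where "z1 \<in> ball 0 R" "z2 \<in> sphere 0 R" "p = F z1" "p = F z2" by blast
      then show False using mixed[of z1 z2] by simp
    qed
    have injc: "inj_on F (cball 0 R)"
    proof (rule inj_onI)
      fix x y assume xy: "x \<in> cball 0 R" "y \<in> cball 0 R" "F x = F y"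
      consider "cmod x < R" "cmod y < R" | "cmod x < R" "cmod y = R" | "cmod x = R" "cmod y < R"
        | "cmod x = R" "cmod y = R"
        using xy by (auto simp: less_le)
      then show "x = y"
      proof cases
        case 1 then show ?thesis using injR xy by (auto simp: inj_on_def)
      next
        case 2 then show ?thesis using mixed[of x y] xy by simp
      next
        case 3 then show ?thesis using mixed[of y x] xy by simp
      next
        case 4 then show ?thesis using step[OF R0 \<open>R < 1\<close> injR disj] xy by (auto simp: inj_on_def)
      qed
    qed
    define c where "c n = R + (1 - R) / real (Suc (Suc n))" for n
    have c: "R < c n" "c n < 1" for n
      using \<open>R < 1\<close> mult_strict_right_mono[of R 1 "1 + real n"] by (auto simp: c_def field_simps)
    have clim: "c \<longlonglongrightarrow> R"
    proof -
      have "(\<lambda>n. R + (1 - R) * (1 / real (Suc (Suc n)))) \<longlonglongrightarrow> R + (1 - R) * 0"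
        by (intro tendsto_intros LIMSEQ_Suc[OF LIMSEQ_Suc[OF lim_1_over_n]])
      then show ?thesis by (simp add: c_def[abs_def])
    qed
    \<comment> \<open>By maximality of \<open>R\<close> every larger disc carries a coincidence; a limit of these coincidences is a
      single point, where local injectivity fails.\<close>
    have "\<exists>x y. cmod x < c n \<and> cmod y < c n \<and> x \<noteq> y \<and> F x = F y" for n
    proof (rule ccontr)
      assume "\<not> ?thesis"
      then have "inj_on F (ball 0 (c n))" by (intro inj_onI) (metis mem_ball_0)
      then have "c n \<in> S" using c[of n] R0 by (auto simp: S_def intro: less_imp_le)
      then have "c n \<le> R" unfolding R_def by (rule cSup_upper[OF _ bdd])
      then show False using c[of n] by simp
    qed
    then obtain X Y where XY: "\<And>n. cmod (X n) < c n" "\<And>n. cmod (Y n) < c n" "\<And>n. X n \<noteq> Y n" "\<And>n. F (X n) = F (Y n)"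
      by metis
    have cpt: "compact (cball (0::complex) 1 \<times> cball (0::complex) 1)" by (intro compact_Times) auto
    have mem: "\<forall>n. (X n, Y n) \<in> cball 0 1 \<times> cball 0 1"
      using less_imp_le[OF less_trans[OF XY(1) c(2)]] less_imp_le[OF less_trans[OF XY(2) c(2)]] by simp
    obtain l s where s: "strict_mono s" "((\<lambda>n. (X n, Y n)) \<circ> s) \<longlonglongrightarrow> l"
      using cpt[unfolded compact_def, rule_format, of "\<lambda>n. (X n, Y n)"] mem by blast
    obtain x y where l: "l = (x, y)" by (cases l)
    have Xs: "(\<lambda>n. X (s n)) \<longlonglongrightarrow> x" and Ys: "(\<lambda>n. Y (s n)) \<longlonglongrightarrow> y"
      using tendsto_fst[OF s(2)] tendsto_snd[OF s(2)] by (simp_all add: l o_def)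
    have cs: "(\<lambda>n. c (s n)) \<longlonglongrightarrow> R" using LIMSEQ_subseq_LIMSEQ[OF clim s(1)] by (simp add: o_def)
    have xR: "cmod x \<le> R" 
      by (rule LIMSEQ_le[OF tendsto_norm[OF Xs] cs]) (use XY(1) in \<open>auto intro: less_imp_le\<close>)
    have yR: "cmod y \<le> R" 
      by (rule LIMSEQ_le[OF tendsto_norm[OF Ys] cs]) (use XY(2) in \<open>auto intro: less_imp_le\<close>)
    have cont: "isCont F z" if "cmod z \<le> R" for z
      using holomorphic_on_imp_differentiable_at[OF hol open_ball, of z] that \<open>R < 1\<close>
      by (simp add: field_differentiable_imp_continuous_at)
    have "(\<lambda>n. F (X (s n))) \<longlonglongrightarrow> F x" "(\<lambda>n. F (X (s n))) \<longlonglongrightarrow> F y"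
      using isCont_tendsto_compose[OF cont[OF xR] Xs] isCont_tendsto_compose[OF cont[OF yR] Ys] XY(4) by simp_all
    then have "F x = F y" by (rule LIMSEQ_unique)
    then have "x = y" using injc xR yR by (auto simp: inj_on_def)
    have x1: "x \<in> ball 0 1" using xR \<open>R < 1\<close> by simp
    obtain r where r: "r > 0" "ball x r \<subseteq> ball 0 1" "inj_on F (ball x r)"
      by (rule has_complex_derivative_locally_injective[OF hol x1 open_ball nz[OF x1]])
    have "\<forall>\<^sub>F n in sequentially. X (s n) \<in> ball x r \<and> Y (s n) \<in> ball x r"
      using topological_tendstoD[OF Xs, of "ball x r"] topological_tendstoD[OF Ys, of "ball x r"] r(1) \<open>x = y\<close>
      by (intro eventually_conj) auto
    from eventually_happens[OF this] obtain n where "X (s n) \<in> ball x r" "Y (s n) \<in> ball x r" by auto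
    then show False using inj_onD[OF r(3) XY(4)] XY(3) by blast
  qed
  then show ?thesis using injR by simp
qed

section \<open>Starlike functions\<close>

text \<open>The form in which starlikeness is used: moving towards the origin along a ray in the image strictly
  decreases the modulus of the preimage. The case \<open>c = 1\<close>, used in both directions, is injectivity.\<close>
definition ray_ordered :: "(complex \<Rightarrow> complex) \<Rightarrow> bool" where
  "ray_ordered \<Phi> \<longleftrightarrow>
     (\<forall>x\<in>ball 0 1. \<forall>y\<in>ball 0 1. \<forall>c::real.
        0 < c \<and> c \<le> 1 \<and> \<Phi> x = of_real c * \<Phi> y \<longrightarrow> x = y \<or> cmod x < cmod y)"

lemma local_inverse:
  fixes g :: "complex \<Rightarrow> complex"
  assumes hol: "g holomorphic_on S" and S: "open S" "z \<in> S" and nz: "deriv g z \<noteq> 0"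
  obtains G e where "e > 0" "G holomorphic_on ball (g z) e" "G (g z) = z"
    "(G has_field_derivative 1 / deriv g z) (at (g z))"
    "\<And>w. w \<in> ball (g z) e \<Longrightarrow> G w \<in> S \<and> g (G w) = w \<and> deriv g (G w) * deriv G w = 1"
proof -
  obtain r where r: "r > 0" "ball z r \<subseteq> S" "open (g ` ball z r)" "inj_on g (ball z r)"
    using has_complex_derivative_locally_invertible[OF hol S(2,1) nz] by blast
  have holr: "g holomorphic_on ball z r" using hol r(2) by (rule holomorphic_on_subset)
  obtain G where G: "G holomorphic_on g ` ball z r"
    "\<And>x. x \<in> ball z r \<Longrightarrow> deriv g x * deriv G (g x) = 1" "\<And>x. x \<in> ball z r \<Longrightarrow> G (g x) = x"
    using holomorphic_has_inverse[OF holr open_ball r(4)] by blast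
  have z: "z \<in> ball z r" using r(1) by simp
  obtain e where e: "e > 0" "ball (g z) e \<subseteq> g ` ball z r"
    using r(3) z open_contains_ball by (metis image_eqI)
  show ?thesis
  proof (rule that[of e G])
    show holG: "G holomorphic_on ball (g z) e" using G(1) e(2) by (rule holomorphic_on_subset)
    show "(G has_field_derivative 1 / deriv g z) (at (g z))"
    proof -
      have "deriv G (g z) = 1 / deriv g z" using G(2)[OF z] nz by (simp add: field_simps)
      then show ?thesis using holomorphic_derivI[OF holG open_ball, of "g z" UNIV] e(1) by simp
    qed
    fix w assume "w \<in> ball (g z) e"
    then obtain x where x: "x \<in> ball z r" "w = g x" using e(2) by blast
    then show "G w \<in> S \<and> g (G w) = w \<and> deriv g (G w) * deriv G w = 1" using r(2) G(2,3)[OF x(1)] by auto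
  qed (use e G(3)[OF z] in auto)
qed

text \<open>If \<open>w(t)\<close> is the local preimage of \<open>t * g z\<close>, then \<open>d/dt log \<bar>w\<bar> = Re (g z / (z * deriv g z))\<close> at
  \<open>t = 1\<close>, which has the sign of \<open>Re (z * deriv g z / g z)\<close>.\<close>
lemma inward_push:
  assumes hol: "g holomorphic_on S" and S: "open S" "z \<in> S"
    and re: "Re (z * deriv g z / g z) > 0"
  obtains t0 :: real where "t0 < 1"
    "\<And>t. t0 < t \<Longrightarrow> t < 1 \<Longrightarrow> \<exists>w\<in>S. cmod w < cmod z \<and> g w = of_real t * g z"
proof -
  have nz: "deriv g z \<noteq> 0" "g z \<noteq> 0" "z \<noteq> 0" using re by auto
  obtain G e where e: "e > 0" and G: "G (g z) = z" "(G has_field_derivative 1 / deriv g z) (at (g z))"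
    "\<And>w. w \<in> ball (g z) e \<Longrightarrow> G w \<in> S \<and> g (G w) = w \<and> deriv g (G w) * deriv G w = 1"
    by (rule local_inverse[OF hol S nz(1)]) blast
  have d1: "(G has_field_derivative 1 / deriv g z) (at (of_real 1 * g z))" using G by simp
  have "((\<lambda>w. G (w * g z)) has_field_derivative g z / deriv g z) (at (of_real 1))"
    by (rule DERIV_chain2[where f = G and g = "\<lambda>w. w * g z", OF d1, THEN DERIV_cong])
       (auto intro!: derivative_eq_intros)
  from has_vector_derivative_real_field[OF this, of UNIV]
  have vd: "((\<lambda>t. G (of_real t * g z)) has_vector_derivative g z / deriv g z) (at 1)" .
  define D where "D = g z / deriv g z"
  note dRe = vd[THEN bounded_linear.has_vector_derivative[OF bounded_linear_Re],
                folded has_real_derivative_iff_has_vector_derivative D_def]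
   and dIm = vd[THEN bounded_linear.has_vector_derivative[OF bounded_linear_Im],
                folded has_real_derivative_iff_has_vector_derivative D_def]
  have der: "((\<lambda>t. (Re (G (of_real t * g z)))\<^sup>2 + (Im (G (of_real t * g z)))\<^sup>2) has_real_derivative
          2 * (Re z * Re D + Im z * Im D)) (at 1)"
    by (rule DERIV_cong[OF DERIV_add[OF DERIV_power[OF dRe, of 2] DERIV_power[OF dIm, of 2]]])
       (use G(1) in \<open>simp add: algebra_simps\<close>)
  have pos: "Re z * Re D + Im z * Im D > 0"
  proof -
    have "z * deriv g z / g z = (z * cnj z) / (cnj z * D)" using nz by (simp add: D_def field_simps)
    also have "\<dots> = of_real ((cmod z)\<^sup>2) / (cnj z * D)" by (simp only: complex_norm_square)
    finally have "Re (of_real ((cmod z)\<^sup>2) / (cnj z * D)) > 0" using re by simp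
    moreover have "of_real ((cmod z)\<^sup>2) / (cnj z * D) = (cmod z)\<^sup>2 *\<^sub>R (1 / (cnj z * D))"
      by (simp add: scaleR_conv_of_real)
    ultimately have "0 < (cmod z)\<^sup>2 * Re (1 / (cnj z * D))" by (simp only: scaleR_complex.sel)
    then have "Re (1 / (cnj z * D)) > 0" by (simp add: zero_less_mult_iff)
    then have "Re (cnj z * D) > 0"
      by (auto simp: Re_divide zero_less_divide_iff sum_power2_gt_zero_iff not_sum_power2_lt_zero)
    then show ?thesis by simp
  qed
  then have pos2: "0 < 2 * (Re z * Re D + Im z * Im D)" by simp
  obtain d where d: "d > 0" "\<And>h. 0 < h \<Longrightarrow> h < d \<Longrightarrow>
     (cmod (G (of_real (1 - h) * g z)))\<^sup>2 < (cmod (G (of_real (1::real) * g z)))\<^sup>2"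
    unfolding cmod_power2 using DERIV_pos_inc_left[OF der pos2] by blast
  show ?thesis
  proof (rule that[of "max (1 - d) (1 - e / cmod (g z))"])
    show "max (1 - d) (1 - e / cmod (g z)) < 1" using d e nz by auto
    fix t :: real assume t: "max (1 - d) (1 - e / cmod (g z)) < t" "t < 1"
    have "g z - of_real t * g z = of_real (1 - t) * g z" by (simp add: algebra_simps)
    then have "dist (g z) (of_real t * g z) = (1 - t) * cmod (g z)"
      using t(2) by (simp add: dist_norm norm_mult del: of_real_diff)
    also have "\<dots> < e" using t nz by (simp add: field_simps)
    finally have b: "of_real t * g z \<in> ball (g z) e" by simp
    have "(cmod (G (of_real t * g z)))\<^sup>2 < (cmod z)\<^sup>2" using d(2)[of "1 - t"] t G(1) by simp
    then have "cmod (G (of_real t * g z)) < cmod z" by (rule power_less_imp_less_base) simp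
    then show "\<exists>w\<in>S. cmod w < cmod z \<and> g w = of_real t * g z" using G(3)[OF b] by blast
  qed
qed

text \<open>The analytic condition for starlikeness. Two preimages of one value on a circle can both be pushed
  inwards along the same ray, which contradicts injectivity inside the circle; and the preimages of
  a ray never stop moving inwards, which orders them by modulus.\<close>
lemma starlike_injective_ray_ordered:
  assumes hol: "g holomorphic_on ball 0 1" and g0: "g 0 = 0" and dg0: "deriv g 0 \<noteq> 0"
    and re: "\<And>z. z \<in> ball 0 1 - {0} \<Longrightarrow> Re (z * deriv g z / g z) > 0"
  shows "inj_on g (ball 0 1)" and "ray_ordered g"
proof -
  have nz: "deriv g z \<noteq> 0" if "z \<in> ball 0 1" for z
    using dg0 re[of z] that by (cases "z = 0") auto
  have gnz: "g z \<noteq> 0" if "z \<in> ball 0 1 - {0}" for z using re[OF that] by auto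
  have push: thesis
    if "z \<in> ball 0 1 - {0}" "open N" "z \<in> N" "N \<subseteq> ball 0 1"
      and "\<And>t0. t0 < 1 \<Longrightarrow> (\<And>t. t0 < t \<Longrightarrow> t < 1 \<Longrightarrow> \<exists>w\<in>N. cmod w < cmod z \<and> g w = of_real t * g z) \<Longrightarrow> thesis"
    for z N thesis
    by (rule inward_push[OF holomorphic_on_subset[OF hol that(4)] that(2,3) re[OF that(1)]])
       (use that(5) in blast)
  show inj: "inj_on g (ball 0 1)"
  proof (rule injective_if_injective_on_spheres[OF hol nz])
    fix \<rho> :: real assume \<rho>: "0 < \<rho>" "\<rho> < 1" "inj_on g (ball 0 \<rho>)" "g ` sphere 0 \<rho> \<inter> g ` ball 0 \<rho> = {}"
    show "inj_on g (sphere 0 \<rho>)"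
    proof (rule inj_onI, rule ccontr)
      fix x y assume xy: "x \<in> sphere 0 \<rho>" "y \<in> sphere 0 \<rho>" "g x = g y" "x \<noteq> y"
      obtain U V where UV: "open U" "open V" "x \<in> U" "y \<in> V" "U \<inter> V = {}" using hausdorff[OF xy(4)] by blast
      have x1: "x \<in> ball 0 1 - {0}" and y1: "y \<in> ball 0 1 - {0}" using xy \<rho> by auto
      obtain t1 where t1: "t1 < 1" "\<And>t. t1 < t \<Longrightarrow> t < 1 \<Longrightarrow> \<exists>w\<in>U \<inter> ball 0 1. cmod w < cmod x \<and> g w = of_real t * g x"
        by (rule push[OF x1, of "U \<inter> ball 0 1"]) (use UV x1 in auto)
      obtain t2 where t2: "t2 < 1" "\<And>t. t2 < t \<Longrightarrow> t < 1 \<Longrightarrow> \<exists>w\<in>V \<inter> ball 0 1. cmod w < cmod y \<and> g w = of_real t * g y"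
        by (rule push[OF y1, of "V \<inter> ball 0 1"]) (use UV y1 in auto)
      obtain t where "max t1 t2 < t" "t < 1" using dense[of "max t1 t2" 1] t1(1) t2(1) by auto
      then obtain w1 w2 where w: "w1 \<in> U" "w2 \<in> V" "cmod w1 < cmod x" "cmod w2 < cmod y" "g w1 = g w2"
        using t1(2)[of t] t2(2)[of t] xy(3) by auto
      then have "w1 = w2" using xy \<rho>(3) by (auto simp: inj_on_def)
      then show False using w UV by auto
    qed
  qed
  have weak: "cmod x \<le> cmod y"
    if x: "x \<in> ball 0 1" and y: "y \<in> ball 0 1" and c: "0 < c" "c \<le> 1" and eq: "g x = of_real c * g y" for x y and c :: real
  proof -
    \<comment> \<open>The parameters that have a preimage no farther out than \<open>y\<close>; inward pushes carry the infimum down to \<open>c\<close>.\<close>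
    define T where "T = {t \<in> {c..1}. of_real t * g y \<in> g ` cball 0 (cmod y)}"
    have "T = {c..1} \<inter> (\<lambda>t. of_real t * g y) -` (g ` cball 0 (cmod y))" by (auto simp: T_def)
    moreover have "compact (g ` cball 0 (cmod y))"
      using hol y by (intro compact_continuous_image) (auto intro!: holomorphic_on_imp_continuous_on elim!: holomorphic_on_subset)
    ultimately have "closed T"
      by (auto intro!: continuous_closed_preimage continuous_intros simp: compact_imp_closed)
    have "1 \<in> T" using c by (auto simp: T_def)
    have bdd: "bdd_below T" by (rule bdd_belowI[of _ c]) (auto simp: T_def)
    have "Inf T \<in> T" using closed_contains_Inf[OF _ bdd \<open>closed T\<close>] \<open>1 \<in> T\<close> by auto
    then obtain w where w: "cmod w \<le> cmod y" "g w = of_real (Inf T) * g y" and I: "c \<le> Inf T" "Inf T \<le> 1"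
      by (auto simp: T_def)
    have "Inf T = c"
    proof (rule ccontr)
      assume "Inf T \<noteq> c"
      with I have cI: "c < Inf T" by simp
      have "y \<noteq> 0"
      proof
        assume "y = 0"
        then have "c \<in> T" using c g0 by (auto simp: T_def)
        then show False using cInf_lower[OF _ bdd] cI by fastforce
      qed
      then have "g y \<noteq> 0" using gnz y by auto
      then have "w \<noteq> 0" using w(2) cI c g0 by auto
      then have w1: "w \<in> ball 0 1 - {0}" using w(1) y by auto
      obtain t0 where t0: "t0 < 1" "\<And>t. t0 < t \<Longrightarrow> t < 1 \<Longrightarrow> \<exists>v\<in>ball 0 1. cmod v < cmod w \<and> g v = of_real t * g w"
        by (rule push[OF w1, of "ball 0 1"]) (use w1 in auto)
      obtain t where t: "max t0 (c / Inf T) < t" "t < 1"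
        using dense[of "max t0 (c / Inf T)" 1] t0(1) cI c by auto
      then obtain v where v: "cmod v < cmod w" "g v = of_real (t * Inf T) * g y"
        using t0(2)[of t] w(2) by (auto simp: mult.assoc)
      have "c < t * Inf T" "t * Inf T < Inf T" using t cI c by (auto simp: field_simps)
      then have "t * Inf T \<in> T"
        using v w(1) I unfolding T_def
        by (intro CollectI conjI image_eqI[of _ _ v]) auto
      then have "Inf T \<le> t * Inf T" by (rule cInf_lower[OF _ bdd])
      then show False using \<open>t * Inf T < Inf T\<close> by simp
    qed
    then have "g w = g x" using w eq by simp
    then have "w = x" using inj w x y by (auto simp: inj_on_def)
    then show ?thesis using w by simp
  qed
  show "ray_ordered g"
    unfolding ray_ordered_def
  proof (intro ballI allI impI, elim conjE)
    fix x y :: complex and c :: real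
    assume x: "x \<in> ball 0 1" and y: "y \<in> ball 0 1" and c: "0 < c" "c \<le> 1" and eq: "g x = of_real c * g y"
    show "x = y \<or> cmod x < cmod y"
    proof (cases "c = 1 \<or> y = 0")
      case True
      then have "g x = g y" using eq g0 by auto
      then show ?thesis using inj x y by (auto simp: inj_on_def)
    next
      case False
      then have y1: "y \<in> ball 0 1 - {0}" and "c < 1" using y c by auto
      obtain t0 where t0: "t0 < 1" "\<And>t. t0 < t \<Longrightarrow> t < 1 \<Longrightarrow> \<exists>v\<in>ball 0 1. cmod v < cmod y \<and> g v = of_real t * g y"
        by (rule push[OF y1, of "ball 0 1"]) (use y1 in auto)
      obtain t where t: "max t0 c < t" "t < 1"
        using dense[of "max t0 c" 1] t0(1) \<open>c < 1\<close> by auto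
      obtain v where v: "v \<in> ball 0 1" "cmod v < cmod y" "g v = of_real t * g y" using t0(2)[of t] t by auto
      then have "g x = of_real (c / t) * g v" using eq t c by simp
      then have "cmod x \<le> cmod v" using weak[OF x v(1), of "c / t"] t c by simp
      then show ?thesis using v by simp
    qed
  qed
qed

text \<open>The geometric condition for starlikeness. The map \<open>z \<mapsto> \<Phi>\<inverse>(c * \<Phi> z)\<close> is a Schwarz function with
  derivative \<open>c\<close> at the origin, and Schwarz's lemma compares \<open>x\<close> with \<open>y\<close>; equality of the moduli
  forces a rotation and hence \<open>c = 1\<close>.\<close>
lemma univalent_starlike_ray_ordered:
  assumes hol: "\<Phi> holomorphic_on ball 0 1" and inj: "inj_on \<Phi> (ball 0 1)" and z0: "\<Phi> 0 = 0"
    and star: "\<And>z t. z \<in> ball 0 1 \<Longrightarrow> 0 \<le> t \<Longrightarrow> t \<le> 1 \<Longrightarrow> of_real t * \<Phi> z \<in> \<Phi> ` ball 0 1"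
  shows "ray_ordered \<Phi>"
  unfolding ray_ordered_def
proof (intro ballI allI impI, elim conjE)
  fix x y :: complex and c :: real
  assume x: "x \<in> ball 0 1" and y: "y \<in> ball 0 1" and c: "0 < c" "c \<le> 1" and eq: "\<Phi> x = of_real c * \<Phi> y"
  obtain G where G: "G holomorphic_on \<Phi> ` ball 0 1" "\<And>z. z \<in> ball 0 1 \<Longrightarrow> deriv \<Phi> z * deriv G (\<Phi> z) = 1"
     "\<And>z. z \<in> ball 0 1 \<Longrightarrow> G (\<Phi> z) = z"
    using holomorphic_has_inverse[OF hol open_ball inj] by blast
  define w where "w z = G (of_real c * \<Phi> z)" for z
  have sub: "of_real c * \<Phi> z \<in> \<Phi> ` ball 0 1" if "z \<in> ball 0 1" for z using star[OF that] c by simp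
  have how: "w holomorphic_on ball 0 1"
    unfolding w_def
    by (rule holomorphic_on_compose_gen[OF _ G(1), unfolded o_def])
       (use sub hol in \<open>auto intro!: holomorphic_intros\<close>)
  have wb: "cmod (w z) < 1" if "cmod z < 1" for z
    using sub[of z] G(3) that by (auto simp: w_def)
  have w0: "w 0 = 0" using G(3)[of 0] z0 by (simp add: w_def)
  have wy: "w y = x" using eq G(3)[OF x] by (simp add: w_def)
  have le: "cmod x \<le> cmod y" using Schwarz_Lemma(1)[OF how w0 wb, of y] y wy by simp
  show "x = y \<or> cmod x < cmod y"
  proof (cases "c = 1 \<or> y = 0 \<or> cmod x < cmod y")
    case True
    then show ?thesis using eq inj x y z0 by (auto simp: inj_on_def)
  next
    case False
    then have "cmod (w y) = cmod y" "y \<noteq> 0" using le wy by auto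
    then obtain \<alpha> where \<alpha>: "\<And>z. cmod z < 1 \<Longrightarrow> w z = \<alpha> * z" "cmod \<alpha> = 1"
      using Schwarz_Lemma(3)[OF how w0 wb, of y] y by auto
    have "deriv w 0 = \<alpha>"
    proof (rule DERIV_imp_deriv)
      show "(w has_field_derivative \<alpha>) (at 0)"
        by (rule has_field_derivative_transform_within_open[where f = "\<lambda>z. \<alpha> * z" and S = "ball 0 1"])
           (use \<alpha> in \<open>auto intro!: derivative_eq_intros\<close>)
    qed
    moreover have "deriv w 0 = of_real c"
    proof (rule DERIV_imp_deriv)
      have op: "open (\<Phi> ` ball 0 1)" by (rule open_mapping_thm3[OF hol open_ball inj])
      have "0 \<in> \<Phi> ` ball 0 1" using z0 by force
      then have dG: "(G has_field_derivative deriv G 0) (at (of_real c * \<Phi> 0))"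
        using holomorphic_derivI[OF G(1) op] z0 by simp
      have dP: "(\<Phi> has_field_derivative deriv \<Phi> 0) (at 0)" using holomorphic_derivI[OF hol open_ball, of 0] by simp
      have "deriv \<Phi> 0 * deriv G 0 = 1" using G(2)[of 0] z0 by simp
      then show "(w has_field_derivative of_real c) (at 0)"
        unfolding w_def
        by (auto intro!: DERIV_chain2[where f = G and g = "\<lambda>z. of_real c * \<Phi> z", OF dG, THEN DERIV_cong] derivative_eq_intros dP simp: algebra_simps)
    qed
    ultimately have "c = 1" using \<alpha>(2) c by auto
    with False show ?thesis by simp
  qed
qed

section \<open>Functions whose radial derivative is starlike\<close>

text \<open>Alexander's correspondence: \<open>z * deriv k z\<close> starlike makes \<open>k\<close> convex and univalent, as shown below.\<close>
locale radial_primitive =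
  fixes k :: "complex \<Rightarrow> complex"
  assumes holk: "k holomorphic_on ball 0 1"
    and k0: "k 0 = 0"
    and nz: "\<And>z. z \<in> ball 0 1 \<Longrightarrow> deriv k z \<noteq> 0"
    and ord: "ray_ordered (\<lambda>z. z * deriv k z)"
begin

lemma continuous_on_k: "S \<subseteq> ball 0 1 \<Longrightarrow> continuous_on S k"
  using holk by (meson holomorphic_on_imp_continuous_on holomorphic_on_subset)

text \<open>The core of the argument, an extension of Jack's lemma to two variables. Let \<open>\<psi>(x, y)\<close> be the
  preimage under \<open>k\<close> of \<open>l * A\<^sub>1 x + (1 - l) * A\<^sub>2 y\<close>, let \<open>(a, b)\<close> maximize \<open>\<bar>\<psi>\<bar>\<close> on the closed bidisc and put
  \<open>\<zeta> = \<psi>(a, b)\<close>. With \<open>\<Phi>(z) = z * deriv k z\<close>, maximality in each variable separately yields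
  \<open>l * \<Phi>(w\<^sub>1 a) = m1 * \<Phi>(\<zeta>)\<close> and \<open>(1 - l) * \<Phi>(w\<^sub>2 b) = m2 * \<Phi>(\<zeta>)\<close> with \<open>m1, m2 \<ge> 0\<close>, and Schwarz's
  lemma along the diagonal \<open>t \<mapsto> (t * a, t * b)\<close> yields \<open>m1 + m2 \<ge> 1\<close>. So \<open>m1 \<ge> l\<close> or \<open>m2 \<ge> 1 - l\<close>, and
  starlikeness of \<open>\<Phi>\<close> gives \<open>\<bar>\<zeta>\<bar> \<le> \<bar>w\<^sub>1 a\<bar>\<close> or \<open>\<bar>\<zeta>\<bar> \<le> \<bar>w\<^sub>2 b\<bar>\<close>.\<close>
lemma bidisc_preimage_bound:
  fixes A\<^sub>1 A\<^sub>2 w\<^sub>1 w\<^sub>2 :: "complex \<Rightarrow> complex" and l r R :: real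
  assumes R: "R \<le> 1" and inj: "inj_on k (ball 0 R)"
    and holA: "A\<^sub>1 holomorphic_on ball 0 1" "A\<^sub>2 holomorphic_on ball 0 1"
    and A0: "A\<^sub>1 0 = 0" "A\<^sub>2 0 = 0"
    and dA1: "\<And>z. z \<in> ball 0 1 \<Longrightarrow> z * deriv A\<^sub>1 z = w\<^sub>1 z * deriv k (w\<^sub>1 z)"
    and dA2: "\<And>z. z \<in> ball 0 1 \<Longrightarrow> z * deriv A\<^sub>2 z = w\<^sub>2 z * deriv k (w\<^sub>2 z)"
    and w1: "\<And>z. z \<in> ball 0 1 \<Longrightarrow> cmod (w\<^sub>1 z) \<le> cmod z"
    and w2: "\<And>z. z \<in> ball 0 1 \<Longrightarrow> cmod (w\<^sub>2 z) \<le> cmod z"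
    and l: "0 < l" "l < 1" and r: "0 \<le> r" "r < R"
    and E: "\<And>x y. cmod x \<le> r \<Longrightarrow> cmod y \<le> r \<Longrightarrow>
              of_real l * A\<^sub>1 x + of_real (1 - l) * A\<^sub>2 y \<in> k ` ball 0 R"
    and xy: "cmod x \<le> r" "cmod y \<le> r"
  shows "of_real l * A\<^sub>1 x + of_real (1 - l) * A\<^sub>2 y \<in> k ` cball 0 r"
proof -
  define S where "S u v = of_real l * A\<^sub>1 u + of_real (1 - l) * A\<^sub>2 v" for u v
  have holkR: "k holomorphic_on ball 0 R" by (rule holomorphic_on_subset[OF holk]) (use R in auto)
  obtain K where K: "K holomorphic_on k ` ball 0 R"
     "\<And>z. z \<in> ball 0 R \<Longrightarrow> deriv k z * deriv K (k z) = 1" "\<And>z. z \<in> ball 0 R \<Longrightarrow> K (k z) = z"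
    using holomorphic_has_inverse[OF holkR open_ball inj] by blast
  have opk: "open (k ` ball 0 R)" by (rule open_mapping_thm3[OF holkR open_ball inj])
  define \<psi> where "\<psi> u v = K (S u v)" for u v
  have kpsi: "k (\<psi> u v) = S u v" "\<psi> u v \<in> ball 0 R" if "cmod u \<le> r" "cmod v \<le> r" for u v
    using E[OF that] K(3) by (auto simp: \<psi>_def S_def)
  have contA: "continuous_on (cball 0 r) A\<^sub>1" "continuous_on (cball 0 r) A\<^sub>2"
    using holA r R by (auto intro!: holomorphic_on_imp_continuous_on elim!: holomorphic_on_subset)
  have contS: "continuous_on (cball 0 r \<times> cball 0 r) (\<lambda>p. S (fst p) (snd p))"
    unfolding S_def
    by (intro continuous_intros continuous_on_compose2[OF contA(1)] continuous_on_compose2[OF contA(2)]) auto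
  have "continuous_on (cball 0 r \<times> cball 0 r) (\<lambda>p. cmod (\<psi> (fst p) (snd p)))"
    unfolding \<psi>_def
    by (intro continuous_on_norm continuous_on_compose2[OF holomorphic_on_imp_continuous_on[OF K(1)] contS])
       (use E in \<open>auto simp: S_def\<close>)
  then obtain p where p: "p \<in> cball 0 r \<times> cball 0 r"
    "\<And>q. q \<in> cball 0 r \<times> cball 0 r \<Longrightarrow> cmod (\<psi> (fst q) (snd q)) \<le> cmod (\<psi> (fst p) (snd p))"
    using continuous_attains_sup[of "cball 0 r \<times> cball (0::complex) r" "\<lambda>p. cmod (\<psi> (fst p) (snd p))"] r
    by (auto simp: compact_Times)
  obtain a b where ab: "p = (a, b)" by (cases p)
  have a: "cmod a \<le> r" and b: "cmod b \<le> r" using p(1) ab by auto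
  have mx: "cmod (\<psi> u v) \<le> cmod (\<psi> a b)" if "cmod u \<le> r" "cmod v \<le> r" for u v
    using p(2)[of "(u, v)"] that ab by auto
  define \<zeta> where "\<zeta> = \<psi> a b"
  have \<zeta>: "\<zeta> \<in> ball 0 R" "k \<zeta> = S a b" "\<zeta> \<in> ball 0 1"
    using kpsi[OF a b] R by (auto simp: \<zeta>_def)
  have "cmod \<zeta> \<le> r"
  proof (cases "\<zeta> = 0")
    case False
    have ball1: "a \<in> ball 0 1" "b \<in> ball 0 1" using a b r R by auto
    have dk: "deriv k \<zeta> \<noteq> 0" by (rule nz[OF \<zeta>(3)])
    have "deriv K (k \<zeta>) = 1 / deriv k \<zeta>" using K(2)[OF \<zeta>(1)] dk by (simp add: field_simps)
    then have dK: "(K has_field_derivative 1 / deriv k \<zeta>) (at (S a b))"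
      using holomorphic_derivI[OF K(1) opk, of "k \<zeta>" UNIV] \<zeta>(1,2) by force
    have dA: "(A\<^sub>1 has_field_derivative deriv A\<^sub>1 a) (at a)" "(A\<^sub>2 has_field_derivative deriv A\<^sub>2 b) (at b)"
      using holomorphic_derivI[OF holA(1) open_ball ball1(1)] holomorphic_derivI[OF holA(2) open_ball ball1(2)] by auto
    have "((\<lambda>z. \<psi> z b) has_field_derivative (of_real l * deriv A\<^sub>1 a) / deriv k \<zeta>) (at a)"
      unfolding \<psi>_def
      by (rule DERIV_chain2[where f = K and g = "\<lambda>z. S z b", OF dK, THEN DERIV_cong])
         (auto simp: S_def intro!: derivative_eq_intros dA)
    then obtain m1 where m1: "m1 \<ge> 0" "a * ((of_real l * deriv A\<^sub>1 a) / deriv k \<zeta>) = of_real m1 * \<zeta>"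
      unfolding \<zeta>_def
      by (rule norm_maximum_on_disc_derivative) (use False mx a b in \<open>auto simp: \<zeta>_def\<close>)
    have "((\<lambda>z. \<psi> a z) has_field_derivative (of_real (1 - l) * deriv A\<^sub>2 b) / deriv k \<zeta>) (at b)"
      unfolding \<psi>_def
      by (rule DERIV_chain2[where f = K and g = "\<lambda>z. S a z", OF dK, THEN DERIV_cong])
         (auto simp: S_def intro!: derivative_eq_intros dA)
    then obtain m2 where m2: "m2 \<ge> 0" "b * ((of_real (1 - l) * deriv A\<^sub>2 b) / deriv k \<zeta>) = of_real m2 * \<zeta>"
      unfolding \<zeta>_def
      by (rule norm_maximum_on_disc_derivative) (use False mx a b in \<open>auto simp: \<zeta>_def\<close>)
    have conv: "c * (x * d) = m * (\<zeta> * deriv k \<zeta>)" if "x * ((c * d) / deriv k \<zeta>) = m * \<zeta>" for c x d m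
      using that dk by (simp add: field_simps)
    note M1 = conv[OF m1(2), unfolded dA1[OF ball1(1)]] and M2 = conv[OF m2(2), unfolded dA2[OF ball1(2)]]
    define d where "d t = \<psi> (t * a) (t * b)" for t
    have scale: "cmod (t * u) \<le> r" if "cmod t \<le> 1" "cmod u \<le> r" for t u
      using that r mult_mono[of "cmod t" 1 "cmod u" r] by (simp add: norm_mult)
    have sc1: "cmod (t * u) < 1" if "cmod t < 1" "cmod u \<le> r" for t u
      using scale[of t u] that r R by linarith
    have d1: "d 1 = \<zeta>" by (simp add: d_def \<zeta>_def)
    have d0: "d 0 = 0" using K(3)[of 0] k0 A0 r by (simp add: d_def \<psi>_def S_def)
    have dder: "(d has_field_derivative of_real (m1 + m2) * \<zeta>) (at 1)"
    proof -
      have dA': "(A\<^sub>1 has_field_derivative deriv A\<^sub>1 a) (at (1 * a))" "(A\<^sub>2 has_field_derivative deriv A\<^sub>2 b) (at (1 * b))"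
        using dA by auto
      have dK': "(K has_field_derivative 1 / deriv k \<zeta>) (at (S (1 * a) (1 * b)))" using dK by simp
      have Sder: "((\<lambda>t. S (t * a) (t * b)) has_field_derivative
              of_real l * (deriv A\<^sub>1 a * a) + of_real (1 - l) * (deriv A\<^sub>2 b * b)) (at 1)"
        unfolding S_def
        by (intro DERIV_add DERIV_cmult DERIV_chain2[where f = A\<^sub>1 and g = "\<lambda>t. t * a", OF dA'(1)]
              DERIV_chain2[where f = A\<^sub>2 and g = "\<lambda>t. t * b", OF dA'(2)])
           (auto intro!: derivative_eq_intros)
      have split: "1 / deriv k \<zeta> * (p * (x * a) + q * (y * b)) = a * ((p * x) / deriv k \<zeta>) + b * ((q * y) / deriv k \<zeta>)" for p q x y
        by (simp add: add_divide_distrib algebra_simps)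
      from DERIV_chain2[where f = K and g = "\<lambda>t. S (t * a) (t * b)", OF dK' Sder]
      show ?thesis
        unfolding d_def \<psi>_def
        by (rule DERIV_cong) (simp only: split m1(2) m2(2) of_real_add distrib_right)
    qed
    \<comment> \<open>Schwarz's lemma needs a strict bound, so it is applied to \<open>d / c\<close> with \<open>c > \<bar>\<zeta>\<bar>\<close>, and \<open>c\<close> then tends to \<open>\<bar>\<zeta>\<bar>\<close>.\<close>
    have dle: "cmod (d t) \<le> c * cmod t" if "cmod t < 1" "c > cmod \<zeta>" for t c
    proof -
      have c: "c > 0" using that(2) norm_ge_zero[of \<zeta>] by linarith
      have hold: "(\<lambda>t. d t / of_real c) holomorphic_on ball 0 1"
        unfolding d_def \<psi>_def
      proof (intro holomorphic_intros holomorphic_on_compose_gen[OF _ K(1), unfolded o_def])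
        have 1: "(\<lambda>t. A\<^sub>1 (t * a)) holomorphic_on ball 0 1"
          by (rule holomorphic_on_compose_gen[OF _ holA(1), unfolded o_def])
             (auto intro!: holomorphic_intros sc1 a)
        have 2: "(\<lambda>t. A\<^sub>2 (t * b)) holomorphic_on ball 0 1"
          by (rule holomorphic_on_compose_gen[OF _ holA(2), unfolded o_def])
             (auto intro!: holomorphic_intros sc1 b)
        show "(\<lambda>t. S (t * a) (t * b)) holomorphic_on ball 0 1"
          unfolding S_def by (intro holomorphic_intros 1 2)
        show "(\<lambda>t. S (t * a) (t * b)) ` ball 0 1 \<subseteq> k ` ball 0 R"
          using E scale a b by (auto simp: S_def less_imp_le)
      qed (use c in auto)
      have "cmod (d s / of_real c) < 1" if "cmod s < 1" for s
        using mx[OF scale scale, of s a s b] that a b \<open>c > cmod \<zeta>\<close> c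
        by (simp add: d_def norm_divide \<zeta>_def)
      then have "cmod (d t / of_real c) \<le> cmod t"
        using Schwarz_Lemma(1)[OF hold _ _ that(1)] d0 by simp
      then show ?thesis using c by (simp add: norm_divide field_simps)
    qed
    have dle': "cmod (d t) \<le> cmod \<zeta> * cmod t" if "cmod t < 1" for t
    proof (rule field_le_epsilon)
      fix e :: real assume "e > 0"
      then have "cmod (d t) \<le> (cmod \<zeta> + e) * cmod t" using dle[OF that, of "cmod \<zeta> + e"] by simp
      also have "\<dots> \<le> cmod \<zeta> * cmod t + e"
        using that \<open>e > 0\<close> by (simp add: algebra_simps mult_left_le)
      finally show "cmod (d t) \<le> cmod \<zeta> * cmod t + e" .
    qed
    have "m1 + m2 \<ge> 1"
    proof (rule ccontr)
      assume neg: "\<not> m1 + m2 \<ge> 1"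
      have "((\<lambda>t. d t / \<zeta> - t) has_field_derivative of_real (m1 + m2) - 1) (at (of_real 1))"
        using False by (auto intro!: derivative_eq_intros dder)
      from has_vector_derivative_real_field[OF this, of UNIV]
      have "((\<lambda>t. Re (d (of_real t) / \<zeta> - of_real t)) has_real_derivative Re (of_real (m1 + m2) - 1)) (at 1)"
        unfolding has_real_derivative_iff_has_vector_derivative
        by (rule bounded_linear.has_vector_derivative[OF bounded_linear_Re])
      then obtain \<delta> where \<delta>: "\<delta> > 0" "\<And>h. 0 < h \<Longrightarrow> h < \<delta> \<Longrightarrow>
          Re (d (of_real (1::real)) / \<zeta> - of_real (1::real)) < Re (d (of_real (1 - h)) / \<zeta> - of_real (1 - h))"
        using DERIV_neg_dec_left[of "\<lambda>t. Re (d (of_real t) / \<zeta> - of_real t)" _ 1] neg by force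
      define h where "h = min (\<delta>/2) (1/2)"
      have h: "0 < h" "h < \<delta>" "h < 1" using \<delta>(1) by (auto simp: h_def)
      have "Re (d (of_real (1 - h)) / \<zeta>) \<le> cmod (d (of_real (1 - h)) / \<zeta>)" by (rule complex_Re_le_cmod)
      also have "\<dots> \<le> 1 - h"
        using dle'[of "of_real (1 - h)"] h False by (simp add: norm_divide field_simps del: of_real_diff)
      finally show False using \<delta>(2)[OF h(1,2)] d1 False by simp
    qed
    then consider "l \<le> m1" | "1 - l \<le> m2" by linarith
    then show ?thesis
    proof cases
      case 1
      have "\<zeta> * deriv k \<zeta> = of_real (l / m1) * (w\<^sub>1 a * deriv k (w\<^sub>1 a))"
        using M1 1 l by (simp add: field_simps)
      moreover have "w\<^sub>1 a \<in> ball 0 1" using w1[OF ball1(1)] ball1 by simp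
      ultimately have "\<zeta> = w\<^sub>1 a \<or> cmod \<zeta> < cmod (w\<^sub>1 a)"
        using ord \<zeta>(3) 1 l unfolding ray_ordered_def by (metis divide_le_eq_1_pos divide_pos_pos less_le_trans)
      then show ?thesis using w1[OF ball1(1)] a by auto
    next
      case 2
      have "\<zeta> * deriv k \<zeta> = of_real ((1 - l) / m2) * (w\<^sub>2 b * deriv k (w\<^sub>2 b))"
        using M2 2 l by (simp add: field_simps)
      moreover have "w\<^sub>2 b \<in> ball 0 1" using w2[OF ball1(2)] ball1 by simp
      moreover have "0 < (1 - l) / m2" "(1 - l) / m2 \<le> 1" using 2 l by auto
      ultimately have "\<zeta> = w\<^sub>2 b \<or> cmod \<zeta> < cmod (w\<^sub>2 b)"
        using ord \<zeta>(3) unfolding ray_ordered_def by blast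
      then show ?thesis using w2[OF ball1(2)] b by auto
    qed
  qed (use r in simp)
  then have "cmod (\<psi> x y) \<le> r" using mx[OF xy] by (simp add: \<zeta>_def)
  then show ?thesis using kpsi(1)[OF xy] by (auto simp: S_def intro!: image_eqI[of _ _ "\<psi> x y"])
qed

text \<open>The preceding bound removes its own assumption that the combination stays in the image: the radii
  for which it does form an interval, closed because the bound is uniform and \<open>k\<close> maps closed discs to compact
  sets, and open because the image of \<open>k\<close> is open. With \<open>w\<^sub>1 = w\<^sub>2 = id\<close> this is convexity of the image, with
  general \<open>w\<^sub>i\<close> it contains the subordination theorem for \<open>z A' = (z k') \<circ> w\<close>.\<close>
lemma convex_combination_in_image:
  fixes A\<^sub>1 A\<^sub>2 w\<^sub>1 w\<^sub>2 :: "complex \<Rightarrow> complex" and l r R :: real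
  assumes R: "R \<le> 1" and inj: "inj_on k (ball 0 R)"
    and holA: "A\<^sub>1 holomorphic_on ball 0 1" "A\<^sub>2 holomorphic_on ball 0 1"
    and A0: "A\<^sub>1 0 = 0" "A\<^sub>2 0 = 0"
    and dA1: "\<And>z. z \<in> ball 0 1 \<Longrightarrow> z * deriv A\<^sub>1 z = w\<^sub>1 z * deriv k (w\<^sub>1 z)"
    and dA2: "\<And>z. z \<in> ball 0 1 \<Longrightarrow> z * deriv A\<^sub>2 z = w\<^sub>2 z * deriv k (w\<^sub>2 z)"
    and w1: "\<And>z. z \<in> ball 0 1 \<Longrightarrow> cmod (w\<^sub>1 z) \<le> cmod z"
    and w2: "\<And>z. z \<in> ball 0 1 \<Longrightarrow> cmod (w\<^sub>2 z) \<le> cmod z"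
    and l: "0 < l" "l < 1" and r: "r < R"
    and xy: "cmod x \<le> r" "cmod y \<le> r"
  shows "of_real l * A\<^sub>1 x + of_real (1 - l) * A\<^sub>2 y \<in> k ` cball 0 r"
proof -
  define S where "S u v = of_real l * A\<^sub>1 u + of_real (1 - l) * A\<^sub>2 v" for u v
  have r0: "0 \<le> r" using xy(1) norm_ge_zero order_trans by blast
  define E where "E s \<longleftrightarrow> (\<forall>u v. cmod u \<le> s \<longrightarrow> cmod v \<le> s \<longrightarrow> S u v \<in> k ` ball 0 R)" for s
  have bound: "S u v \<in> k ` cball 0 s" if "E s" "0 \<le> s" "s < R" "cmod u \<le> s" "cmod v \<le> s" for s u v
    unfolding S_def
    by (rule bidisc_preimage_bound[OF R inj holA A0 dA1 dA2 w1 w2 l that(2,3) _ that(4,5)])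
       (use that(1) in \<open>auto simp: E_def S_def\<close>)
  define I where "I = {s \<in> {0..r}. E s}"
  have "k ` {0} \<subseteq> k ` ball 0 R" using r r0 by auto
  then have I0: "0 \<in> I" using A0 r0 k0 by (auto simp: I_def E_def S_def)
  have bdd: "bdd_above I" by (rule bdd_aboveI[of _ r]) (auto simp: I_def)
  define s where "s = Sup I"
  have s0: "0 \<le> s" unfolding s_def by (rule cSup_upper[OF I0 bdd])
  have sr: "s \<le> r" unfolding s_def by (rule cSup_least) (use I0 in \<open>auto simp: I_def\<close>)
  have contA: "continuous_on (cball 0 t) A\<^sub>1" "continuous_on (cball 0 t) A\<^sub>2" if "t < 1" for t
    using holA that by (auto intro!: holomorphic_on_imp_continuous_on elim!: holomorphic_on_subset)
  have cpt: "compact (k ` cball 0 s)"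
    using sr r R by (intro compact_continuous_image continuous_on_k) auto
  have shrink: "cmod (u * of_real (1 - 1 / real (Suc n))) \<le> t * (1 - 1 / real (Suc n))" if "cmod u \<le> t" for u n t
  proof -
    have "0 \<le> 1 - 1 / real (Suc n)" by simp
    then show ?thesis
      unfolding norm_mult norm_of_real abs_of_nonneg[OF \<open>0 \<le> 1 - 1 / real (Suc n)\<close>]
      using that by (rule mult_right_mono[rotated])
  qed
  have cs: "S u v \<in> k ` cball 0 s" if uv: "cmod u \<le> s" "cmod v \<le> s" for u v
  proof (cases "s = 0")
    case True
    then show ?thesis using uv A0 k0 by (auto simp: S_def intro!: image_eqI[of _ _ 0])
  next
    case False
    have mem: "S (u * of_real (1 - 1 / real (Suc n))) (v * of_real (1 - 1 / real (Suc n))) \<in> k ` cball 0 s" for n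
    proof -
      have "s * (1 - 1 / real (Suc n)) < Sup I" using False s0 by (simp add: s_def[symmetric] field_simps)
      then obtain t where t: "t \<in> I" "s * (1 - 1 / real (Suc n)) < t"
        using less_cSup_iff[OF _ bdd] I0 by blast
      have "S (u * of_real (1 - 1 / real (Suc n))) (v * of_real (1 - 1 / real (Suc n))) \<in> k ` cball 0 t"
        using t r shrink[OF uv(1), of n] shrink[OF uv(2), of n]
        by (intro bound) (auto simp: I_def)
      moreover have "t \<le> s" unfolding s_def by (rule cSup_upper[OF t(1) bdd])
      ultimately show ?thesis by auto
    qed
    have lim: "(\<lambda>n. z * of_real (1 - 1 / real (Suc n))) \<longlonglongrightarrow> z * of_real (1 - 0)" for z :: complex
      by (intro tendsto_intros LIMSEQ_Suc[OF lim_1_over_n])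
    have "s < 1" using sr r R by simp
    have c1: "isCont A\<^sub>1 u"
      using holomorphic_on_imp_differentiable_at[OF holA(1) open_ball, of u] uv \<open>s < 1\<close>
      by (simp add: field_differentiable_imp_continuous_at)
    have c2: "isCont A\<^sub>2 v"
      using holomorphic_on_imp_differentiable_at[OF holA(2) open_ball, of v] uv \<open>s < 1\<close>
      by (simp add: field_differentiable_imp_continuous_at)
    have "(\<lambda>n. S (u * of_real (1 - 1 / real (Suc n))) (v * of_real (1 - 1 / real (Suc n)))) \<longlonglongrightarrow> S u v"
      unfolding S_def
      by (intro tendsto_intros isCont_tendsto_compose[OF c1] isCont_tendsto_compose[OF c2])
         (use lim[of u] lim[of v] in simp_all)
    with mem show ?thesis by (rule closed_sequentially[OF compact_imp_closed[OF cpt]])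
  qed
  have "s = r"
  proof (rule ccontr)
    assume "s \<noteq> r"
    with sr have "s < r" by simp
    have holkR: "k holomorphic_on ball 0 R" by (rule holomorphic_on_subset[OF holk]) (use R in auto)
    have opk: "open (k ` ball 0 R)" by (rule open_mapping_thm3[OF holkR open_ball inj])
    have "k ` cball 0 s \<subseteq> k ` ball 0 R" using \<open>s < r\<close> r by auto
    then obtain e where e: "e > 0" "(\<Union>z\<in>k ` cball 0 s. ball z e) \<subseteq> k ` ball 0 R"
      using compact_subset_open_imp_ball_epsilon_subset[OF cpt opk] by blast
    have "r < 1" using r R by simp
    obtain d1 where d1: "d1 > 0" "\<And>u v. u \<in> cball 0 r \<Longrightarrow> v \<in> cball 0 r \<Longrightarrow> dist v u < d1 \<Longrightarrow> dist (A\<^sub>1 v) (A\<^sub>1 u) < e"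
      using compact_uniformly_continuous[OF contA(1)[OF \<open>r < 1\<close>] compact_cball] e(1)
      unfolding uniformly_continuous_on_def by metis
    obtain d2 where d2: "d2 > 0" "\<And>u v. u \<in> cball 0 r \<Longrightarrow> v \<in> cball 0 r \<Longrightarrow> dist v u < d2 \<Longrightarrow> dist (A\<^sub>2 v) (A\<^sub>2 u) < e"
      using compact_uniformly_continuous[OF contA(2)[OF \<open>r < 1\<close>] compact_cball] e(1)
      unfolding uniformly_continuous_on_def by metis
    define t where "t = min r (s + min d1 d2 / 2)"
    have t: "s < t" "t \<le> r" "t - s < d1" "t - s < d2" using \<open>s < r\<close> d1(1) d2(1) by (auto simp: t_def)
    define q where "q u = u * of_real (s / t)" for u :: complex
    have q: "cmod (q u) \<le> s" "dist (q u) u \<le> t - s" if "cmod u \<le> t" for u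
    proof -
      have "cmod (q u) = cmod u * (s / t)" using s0 t by (simp add: q_def norm_mult norm_divide)
      also have "\<dots> \<le> t * (s / t)" using that s0 t by (intro mult_right_mono) auto
      finally show "cmod (q u) \<le> s" using t s0 by simp
      have "u - q u = u * of_real (1 - s / t)" by (simp add: q_def algebra_simps)
      then have "dist (q u) u = cmod u * (1 - s / t)"
        using s0 t by (simp add: dist_norm norm_minus_commute norm_mult del: of_real_diff of_real_divide)
      also have "\<dots> \<le> t * (1 - s / t)" using that s0 t by (intro mult_right_mono) auto
      also have "\<dots> = t - s" using t s0 by (simp add: field_simps)
      finally show "dist (q u) u \<le> t - s" .
    qed
    have "E t"
      unfolding E_def
    proof (intro allI impI)
      fix u v assume u: "cmod u \<le> t" and v: "cmod v \<le> t"
      have "dist (A\<^sub>1 (q u)) (A\<^sub>1 u) < e" "dist (A\<^sub>2 (q v)) (A\<^sub>2 v) < e"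
        using q[OF u] q[OF v] u v t by (auto intro!: d1(2) d2(2))
      then have 1: "cmod (A\<^sub>1 (q u) - A\<^sub>1 u) < e" "cmod (A\<^sub>2 (q v) - A\<^sub>2 v) < e" by (simp_all add: dist_norm)
      have "S (q u) (q v) - S u v = of_real l * (A\<^sub>1 (q u) - A\<^sub>1 u) + of_real (1 - l) * (A\<^sub>2 (q v) - A\<^sub>2 v)"
        by (simp add: S_def algebra_simps)
      also have "cmod \<dots> \<le> l * cmod (A\<^sub>1 (q u) - A\<^sub>1 u) + (1 - l) * cmod (A\<^sub>2 (q v) - A\<^sub>2 v)"
        by (rule order_trans[OF norm_triangle_ineq]) (use l in \<open>simp add: norm_mult del: of_real_diff\<close>)
      also have "\<dots> < l * e + (1 - l) * e" using 1 l by (intro add_strict_mono mult_strict_left_mono) auto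
      finally have "S u v \<in> ball (S (q u) (q v)) e" by (simp add: dist_norm algebra_simps)
      moreover have "S (q u) (q v) \<in> k ` cball 0 s" using cs q u v by simp
      ultimately show "S u v \<in> k ` ball 0 R" using e(2) by blast
    qed
    then have "t \<in> I" using t s0 by (auto simp: I_def)
    then have "t \<le> s" unfolding s_def by (rule cSup_upper[OF _ bdd])
    then show False using t by simp
  qed
  then show ?thesis using cs xy by (simp add: S_def)
qed

lemma convex_image_cball:
  assumes R: "R \<le> 1" and inj: "inj_on k (ball 0 R)" and r: "r < R"
  shows "convex (k ` cball 0 r)"
  unfolding convex_alt
proof (intro ballI allI impI)
  fix p q and u :: real assume p: "p \<in> k ` cball 0 r" and q: "q \<in> k ` cball 0 r" and u: "0 \<le> u \<and> u \<le> 1"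
  show "(1 - u) *\<^sub>R p + u *\<^sub>R q \<in> k ` cball 0 r"
  proof (cases "u = 0 \<or> u = 1")
    case True
    then show ?thesis using p q by auto
  next
    case False
    then have u: "0 < 1 - u" "1 - u < 1" using u by auto
    obtain x y where "p = k x" "q = k y" "cmod x \<le> r" "cmod y \<le> r" using p q by auto
    then show ?thesis
      using convex_combination_in_image[OF R inj holk holk k0 k0 refl refl order_refl order_refl u r, of x y]
      by (simp add: scaleR_conv_of_real)
  qed
qed

lemma convex_image_ball:
  assumes R: "R \<le> 1" and inj: "inj_on k (ball 0 R)"
  shows "convex (k ` ball 0 R)"
  unfolding convex_alt
proof (intro ballI allI impI)
  fix p q and u :: real assume p: "p \<in> k ` ball 0 R" and q: "q \<in> k ` ball 0 R" and u: "0 \<le> u \<and> u \<le> 1"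
  obtain x y where xy: "p = k x" "q = k y" "cmod x < R" "cmod y < R" using p q by auto
  define r where "r = max (cmod x) (cmod y)"
  have r: "r < R" using xy by (simp add: r_def)
  have "p \<in> k ` cball 0 r" "q \<in> k ` cball 0 r" using xy by (auto simp: r_def)
  then have "(1 - u) *\<^sub>R p + u *\<^sub>R q \<in> k ` cball 0 r"
    using convex_image_cball[OF R inj r] u unfolding convex_alt by blast
  also have "\<dots> \<subseteq> k ` ball 0 R" using r by auto
  finally show "(1 - u) *\<^sub>R p + u *\<^sub>R q \<in> k ` ball 0 R" .
qed

text \<open>If \<open>k x = k y\<close> on a bounding circle, the convex image of the disc has a supporting line there.
  The linear functional of this line is maximal at both \<open>x\<close> and \<open>y\<close>, so \<open>x * deriv k x\<close> and \<open>y * deriv k y\<close> lie on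
  one ray, and points of equal modulus with this property coincide.\<close>
lemma injective: "inj_on k (ball 0 1)"
proof (rule injective_if_injective_on_spheres[OF holk nz])
  fix \<rho> :: real assume \<rho>: "0 < \<rho>" "\<rho> < 1" and inj: "inj_on k (ball 0 \<rho>)"
    and disj: "k ` sphere 0 \<rho> \<inter> k ` ball 0 \<rho> = {}"
  have cvx: "convex (k ` ball 0 \<rho>)" by (rule convex_image_ball[OF _ inj]) (use \<rho> in simp)
  show "inj_on k (sphere 0 \<rho>)"
  proof (rule inj_onI)
    fix x y assume xy: "x \<in> sphere 0 \<rho>" "y \<in> sphere 0 \<rho>" "k x = k y"
    have x1: "x \<in> ball 0 1" and y1: "y \<in> ball 0 1" using xy \<rho> by auto
    have "k x \<notin> k ` ball 0 \<rho>" using disj xy(1) by blast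
    then obtain e b where e: "e \<noteq> 0" "\<And>p. p \<in> k ` ball 0 \<rho> \<Longrightarrow> inner e p \<le> b" "b \<le> inner e (k x)"
      using separating_hyperplane_sets[OF cvx, of "{k x}"] \<rho> by auto
    have "k ` closure (ball 0 \<rho>) \<subseteq> {p. inner e p \<le> inner e (k x)}"
    proof (rule image_closure_subset)
      show "continuous_on (closure (ball 0 \<rho>)) k" using \<rho> by (intro continuous_on_k) auto
      show "closed {p. inner e p \<le> inner e (k x)}" by (rule closed_halfspace_le)
      show "k ` ball 0 \<rho> \<subseteq> {p. inner e p \<le> inner e (k x)}" using e(2,3) by force
    qed
    then have mx: "Re (cnj e * k z) \<le> Re (cnj e * k x)" if "cmod z \<le> \<rho>" for z
      using \<rho> that by (fastforce simp: inner_complex_def)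
    obtain m1 where m1: "m1 \<ge> 0" "x * deriv k x = of_real m1 * e"
      by (rule inner_maximum_on_disc_derivative[OF holomorphic_derivI[OF holk open_ball x1] e(1)]) (use mx xy in auto)
    obtain m2 where m2: "m2 \<ge> 0" "y * deriv k y = of_real m2 * e"
      by (rule inner_maximum_on_disc_derivative[OF holomorphic_derivI[OF holk open_ball y1] e(1)]) (use mx xy in auto)
    have "x \<noteq> 0" "y \<noteq> 0" using xy \<rho> by auto
    then have pos: "m1 > 0" "m2 > 0" using m1 m2 nz[OF x1] nz[OF y1] by (auto simp: less_le)
    have "x = y \<or> cmod x < cmod y" if "m1 \<le> m2"
    proof -
      have "x * deriv k x = of_real (m1 / m2) * (y * deriv k y)" using m1 m2 pos by simp
      then show ?thesis using ord x1 y1 pos that unfolding ray_ordered_def by (metis divide_le_eq_1_pos divide_pos_pos)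
    qed
    moreover have "y = x \<or> cmod y < cmod x" if "m2 \<le> m1"
    proof -
      have "y * deriv k y = of_real (m2 / m1) * (x * deriv k x)" using m1 m2 pos by simp
      then show ?thesis using ord x1 y1 pos that unfolding ray_ordered_def by (metis divide_le_eq_1_pos divide_pos_pos)
    qed
    ultimately show "x = y" using xy by fastforce
  qed
qed

end

section \<open>Close-to-convex functions and omitted values\<close>

text \<open>Kaplan's criterion for close-to-convex functions: \<open>f \<circ> G\<inverse>\<close> has a derivative with positive real part on a
  convex domain, so it is injective by integration along segments (Noshiro and Warschawski).\<close>
lemma injective_if_derivative_quotient_Re_pos:
  assumes holf: "f holomorphic_on ball 0 1" and holG: "G holomorphic_on ball 0 1"
    and inj: "inj_on G (ball 0 1)" and cvx: "convex (G ` ball 0 1)"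
    and re: "\<And>z. z \<in> ball 0 1 \<Longrightarrow> Re (deriv f z / deriv G z) > 0"
  shows "inj_on f (ball 0 1)"
proof (rule inj_onI, rule ccontr)
  fix x y assume x: "x \<in> ball 0 1" and y: "y \<in> ball 0 1" and eq: "f x = f y" and ne: "x \<noteq> y"
  obtain K where K: "K holomorphic_on G ` ball 0 1"
     "\<And>z. z \<in> ball 0 1 \<Longrightarrow> deriv G z * deriv K (G z) = 1" "\<And>z. z \<in> ball 0 1 \<Longrightarrow> K (G z) = z"
    using holomorphic_has_inverse[OF holG open_ball inj] by blast
  have op: "open (G ` ball 0 1)" by (rule open_mapping_thm3[OF holG open_ball inj])
  define c where "c = G y - G x"
  have c: "c \<noteq> 0" using inj x y ne by (auto simp: c_def inj_on_def)
  define u where "u t = Re (f (K (G x + of_real t * c)) / c)" for t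
  have "u 0 < u 1"
  proof (rule DERIV_pos_imp_increasing[OF zero_less_one])
    fix t :: real assume t: "0 \<le> t" "t \<le> 1"
    have "G x + of_real t * c = (1 - t) *\<^sub>R G x + t *\<^sub>R G y"
      by (simp add: c_def scaleR_conv_of_real algebra_simps)
    also have "\<dots> \<in> G ` ball 0 1" using cvx x y t unfolding convex_alt by blast
    finally obtain z where z: "z \<in> ball 0 1" "G x + of_real t * c = G z" by blast
    have dK: "(K has_field_derivative deriv K (G z)) (at (G x + of_real t * c))"
      using holomorphic_derivI[OF K(1) op, of "G z" UNIV] z by simp
    have df: "(f has_field_derivative deriv f z) (at (K (G x + of_real t * c)))"
      using holomorphic_derivI[OF holf open_ball, of z UNIV] z K(3) by simp
    have "((\<lambda>s. f (K (G x + s * c)) / c) has_field_derivative (deriv f z * (deriv K (G z) * c)) / c) (at (of_real t))"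
      by (rule DERIV_cdivide[OF DERIV_chain2[where f = f and g = "\<lambda>s. K (G x + s * c)", OF df
            DERIV_chain2[where f = K and g = "\<lambda>s. G x + s * c", OF dK]]])
         (auto intro!: derivative_eq_intros)
    also have "(deriv f z * (deriv K (G z) * c)) / c = deriv f z / deriv G z"
    proof -
      have "deriv G z \<noteq> 0" using K(2)[OF z(1)] by auto
      then show ?thesis using K(2)[OF z(1)] c by (simp add: nonzero_eq_divide_eq ac_simps)
    qed
    finally have "(u has_real_derivative Re (deriv f z / deriv G z)) (at t)"
      using has_vector_derivative_real_field[of "\<lambda>s. f (K (G x + s * c)) / c" _ t UNIV]
      unfolding u_def has_real_derivative_iff_has_vector_derivative
      by (intro bounded_linear.has_vector_derivative[OF bounded_linear_Re]) simp
    then show "\<exists>d. (u has_real_derivative d) (at t) \<and> d > 0" using re[OF z(1)] by blast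
  qed
  moreover have "u 0 = u 1" using K(3) x y eq by (simp add: u_def c_def)
  ultimately show False by simp
qed

text \<open>Otherwise the inverse function would be entire and bounded.\<close>
lemma injective_image_not_UNIV:
  assumes hol: "f holomorphic_on ball 0 1" and inj: "inj_on f (ball 0 1)"
  shows "f ` ball 0 1 \<noteq> UNIV"
proof
  assume U: "f ` ball 0 1 = UNIV"
  obtain K where K: "K holomorphic_on f ` ball 0 1" "\<And>z. z \<in> ball 0 1 \<Longrightarrow> deriv f z * deriv K (f z) = 1"
     "\<And>z. z \<in> ball 0 1 \<Longrightarrow> K (f z) = z"
    using holomorphic_has_inverse[OF hol open_ball inj] by blast
  have "K w \<in> ball 0 1" for w
  proof -
    have "w \<in> f ` ball 0 1" using U by simp
    then obtain z where "z \<in> ball 0 1" "w = f z" by blast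
    then show ?thesis using K(3) by simp
  qed
  then have "range K \<subseteq> ball 0 1" by blast
  then have "bounded (range K)" by (rule bounded_subset[OF bounded_ball])
  then have "K constant_on UNIV" using Liouville_theorem K(1) U by simp
  then have "K (f 0) = K (f (1/2))" by (auto simp: constant_on_def)
  then show False using K(3)[of 0] K(3)[of "1/2"] by simp
qed

text \<open>If \<open>w = T\<^sub>1 * e\<close> with \<open>\<bar>e\<bar> = 1\<close>, preimages of \<open>T * e\<close> are continued in \<open>T\<close>. A preimage curve \<open>\<gamma>\<close>
  moves outwards at speed at most \<open>1 / \<bar>f'\<bar> \<le> 1 / H'(\<bar>\<gamma>\<bar>)\<close>, so \<open>H \<bar>\<gamma>\<bar> \<le> T\<close> is preserved and keeps the preimages
  inside a compact disc. The invariant concerns single preimages, so local inverses suffice to propagate it.\<close>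
lemma ball_subset_image:
  fixes H H' :: "real \<Rightarrow> real"
  assumes hol: "f holomorphic_on ball 0 1" and f0: "f 0 = 0"
    and H0: "H 0 = 0" and Hcont: "continuous_on {0..<1} H"
    and Hd: "\<And>t. 0 < t \<Longrightarrow> t < 1 \<Longrightarrow> (H has_real_derivative H' t) (at t)"
    and Hpos: "\<And>t. 0 < t \<Longrightarrow> t < 1 \<Longrightarrow> 0 < H' t"
    and dnz: "deriv f 0 \<noteq> 0"
    and fd: "\<And>z. z \<in> ball 0 1 - {0} \<Longrightarrow> H' (cmod z) \<le> cmod (deriv f z)"
    and s: "0 < s" "s < 1" and w: "cmod w < H s"
  shows "w \<in> f ` ball 0 1"
proof (cases "w = 0")
  case True
  then show ?thesis using f0 by (auto intro!: image_eqI[of _ _ 0])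
next
  case False
  have mono: "H a < H b" if "0 \<le> a" "a < b" "b < 1" for a b
  proof (rule DERIV_pos_imp_increasing_open[OF that(2)])
    show "continuous_on {a..b} H" using Hcont by (rule continuous_on_subset) (use that in auto)
    fix x assume "a < x" "x < b"
    then show "\<exists>y. (H has_real_derivative y) (at x) \<and> 0 < y" using Hd[of x] Hpos[of x] that by auto
  qed
  define e where "e = w / of_real (cmod w)"
  have e: "cmod e = 1" "w = of_real (cmod w) * e" using False
    by (simp_all add: e_def norm_divide)
  define T\<^sub>1 where "T\<^sub>1 = cmod w"
  define Z where "Z = {z \<in> cball 0 s. f z = of_real (cmod (f z)) * e \<and> cmod (f z) \<le> T\<^sub>1 \<and> H (cmod z) \<le> cmod (f z)}"
  define I where "I = (\<lambda>z. cmod (f z)) ` Z"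
  have contf: "continuous_on (cball 0 s) f"
    using hol by (rule holomorphic_on_imp_continuous_on[OF holomorphic_on_subset]) (use s in auto)
  have contH: "continuous_on (cball 0 s) (\<lambda>z::complex. H (cmod z))"
    by (rule continuous_on_compose2[OF Hcont]) (use s in \<open>auto intro!: continuous_intros\<close>)
  have "Z = {z \<in> cball 0 s. cmod (f z - of_real (cmod (f z)) * e) \<le> 0} \<inter> {z \<in> cball 0 s. cmod (f z) \<le> T\<^sub>1}
              \<inter> {z \<in> cball 0 s. H (cmod z) \<le> cmod (f z)}"
    unfolding Z_def norm_le_zero_iff right_minus_eq by blast
  also have "closed \<dots>"
    by (intro closed_Int continuous_on_closed_Collect_le continuous_intros contf contH closed_cball)
  finally have "closed Z" .
  moreover have Zs: "Z \<subseteq> cball 0 s" unfolding Z_def by blast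
  then have "bounded Z" by (rule bounded_subset[OF bounded_cball])
  ultimately have "compact Z" by (simp add: compact_eq_bounded_closed)
  have cptI: "compact I"
    unfolding I_def
    by (intro compact_continuous_image continuous_on_norm continuous_on_subset[OF contf] \<open>compact Z\<close> Zs)
  have bdI: "bdd_above I" by (intro bounded_imp_bdd_above compact_imp_bounded cptI)
  have "0 \<in> Z" using f0 H0 s by (simp add: Z_def T\<^sub>1_def)
  then have I0: "0 \<in> I" using f0 unfolding I_def by (intro image_eqI[of _ _ 0]) auto
  define T where "T = Sup I"
  have TI: "T \<in> I" unfolding T_def
    by (rule closed_contains_Sup[OF _ bdI compact_imp_closed[OF cptI]]) (use I0 in auto)
  have Tup: "t \<le> T" if "t \<in> I" for t unfolding T_def by (rule cSup_upper[OF that bdI])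
  obtain z where zZ: "z \<in> Z" and zT: "T = cmod (f z)" using TI unfolding I_def by blast
  from zZ have z: "cmod z \<le> s" "f z = of_real T * e" "T \<le> T\<^sub>1" "H (cmod z) \<le> T"
    unfolding zT Z_def mem_Collect_eq mem_cball_0 by blast+
  have T0: "0 \<le> T" using zT by simp
  have "T = T\<^sub>1"
  proof (rule ccontr)
    assume "T \<noteq> T\<^sub>1"
    then have TT: "T < T\<^sub>1" using z by simp
    have z1: "z \<in> ball 0 1" using z(1) s by simp
    have "deriv f z \<noteq> 0" using dnz fd[of z] z1 Hpos[of "cmod z"] by (cases "z = 0") auto
    then obtain G \<epsilon> where G: "\<epsilon> > 0" "G holomorphic_on ball (f z) \<epsilon>" "G (f z) = z"
      "\<And>w. w \<in> ball (f z) \<epsilon> \<Longrightarrow> G w \<in> ball 0 1 \<and> f (G w) = w \<and> deriv f (G w) * deriv G w = 1"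
      by (rule local_inverse[OF hol open_ball z1]) blast
    define T' where "T' = min T\<^sub>1 (T + \<epsilon> / 2)"
    have T': "T < T'" "T' \<le> T\<^sub>1" "T' - T < \<epsilon>" using TT G(1) by (auto simp: T'_def)
    have inb: "of_real t * e \<in> ball (f z) \<epsilon>" if "T \<le> t" "t \<le> T'" for t
    proof -
      have "f z - of_real t * e = of_real (T - t) * e" using z(2) by (simp add: algebra_simps)
      then have "dist (f z) (of_real t * e) = \<bar>T - t\<bar>" unfolding dist_norm by (simp only: norm_mult norm_of_real e(1) mult_1_right)
      then show ?thesis using that T' by simp
    qed
    define \<gamma> where "\<gamma> t = G (of_real t * e)" for t :: real
    have \<gamma>: "\<gamma> t \<in> ball 0 1" "f (\<gamma> t) = of_real t * e" "deriv f (\<gamma> t) * deriv G (of_real t * e) = 1"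
      if "T \<le> t" "t \<le> T'" for t
      using G(4)[OF inb[OF that]] by (auto simp: \<gamma>_def)
    have con\<gamma>: "continuous_on {T..T'} \<gamma>"
      unfolding \<gamma>_def
      by (rule continuous_on_compose2[OF holomorphic_on_imp_continuous_on[OF G(2)]])
         (use inb in \<open>auto intro!: continuous_intros\<close>)
    have "H (cmod (\<gamma> T')) - T' \<le> H (cmod (\<gamma> T)) - T"
    proof (rule DERIV_nonpos_imp_decreasing_open[of T T' "\<lambda>t. H (cmod (\<gamma> t)) - t"])
      show "continuous_on {T..T'} (\<lambda>t. H (cmod (\<gamma> t)) - t)"
        by (intro continuous_intros continuous_on_compose2[OF Hcont] con\<gamma>) (use \<gamma>(1) in auto)
      fix t assume t: "T < t" "t < T'"
      then have t': "T \<le> t" "t \<le> T'" by auto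
      have "\<gamma> t \<noteq> 0"
      proof
        assume "\<gamma> t = 0"
        then have "cmod (of_real t * e) = 0" using \<gamma>(2)[OF t'] f0 by simp
        then show False using e(1) T0 t(1) by (simp only: norm_mult norm_of_real)
      qed
      have dG: "(G has_field_derivative deriv G (of_real t * e)) (at (of_real t * e))"
        using holomorphic_derivI[OF G(2) open_ball inb[OF t']] .
      define g' where "g' = deriv G (of_real t * e) * e"
      have "((\<lambda>s. G (s * e)) has_field_derivative g') (at (of_real t))"
        unfolding g'_def
        by (rule DERIV_chain2[where f = G and g = "\<lambda>s. s * e", OF dG]) (auto intro!: derivative_eq_intros)
      then have "(\<gamma> has_vector_derivative g') (at t)"
        unfolding \<gamma>_def by (rule has_vector_derivative_real_field)
      then have "(\<gamma> has_derivative (\<lambda>h. h *\<^sub>R g')) (at t)" by (simp only: has_vector_derivative_def)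
      from has_derivative_compose[OF this has_derivative_norm[OF \<open>\<gamma> t \<noteq> 0\<close>]]
      have ud: "((\<lambda>t. cmod (\<gamma> t)) has_real_derivative inner g' (sgn (\<gamma> t))) (at t)"
        unfolding has_field_derivative_def
        by (rule has_derivative_eq_rhs) (simp add: fun_eq_iff mult.commute)
      have r: "0 < cmod (\<gamma> t)" "cmod (\<gamma> t) < 1" using \<open>\<gamma> t \<noteq> 0\<close> \<gamma>(1)[OF t'] by auto
      have D: "((\<lambda>t. H (cmod (\<gamma> t)) - t) has_real_derivative
                 H' (cmod (\<gamma> t)) * inner g' (sgn (\<gamma> t)) - 1) (at t)"
        by (intro DERIV_diff DERIV_ident DERIV_chain2[OF Hd[OF r] ud])
      have "inner g' (sgn (\<gamma> t)) \<le> cmod g' * cmod (sgn (\<gamma> t))" by (rule norm_cauchy_schwarz)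
      also have "\<dots> = cmod (deriv G (of_real t * e))" using e(1) \<open>\<gamma> t \<noteq> 0\<close> by (simp add: g'_def norm_mult norm_sgn)
      finally have "H' (cmod (\<gamma> t)) * inner g' (sgn (\<gamma> t)) \<le> H' (cmod (\<gamma> t)) * cmod (deriv G (of_real t * e))"
        using Hpos[OF r] by (intro mult_left_mono) auto
      also have "\<dots> \<le> cmod (deriv f (\<gamma> t)) * cmod (deriv G (of_real t * e))"
        using fd[of "\<gamma> t"] \<open>\<gamma> t \<noteq> 0\<close> \<gamma>(1)[OF t'] by (intro mult_right_mono) auto
      also have "\<dots> = 1" using arg_cong[OF \<gamma>(3)[OF t'], of cmod] by (simp add: norm_mult)
      finally show "\<exists>y. ((\<lambda>t. H (cmod (\<gamma> t)) - t) has_real_derivative y) (at t) \<and> y \<le> 0"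
        using D by (intro exI[of _ "H' (cmod (\<gamma> t)) * inner g' (sgn (\<gamma> t)) - 1"]) auto
    qed (use T' in auto)
    then have HT': "H (cmod (\<gamma> T')) \<le> T'" using z(4) G(3) z(2) by (simp add: \<gamma>_def)
    have T'': "T \<le> T'" using T' by simp
    have "cmod (\<gamma> T') < s"
    proof (rule ccontr)
      assume "\<not> cmod (\<gamma> T') < s"
      then have "H s \<le> H (cmod (\<gamma> T'))"
        using mono[of s "cmod (\<gamma> T')"] s \<gamma>(1)[OF T'' order_refl] by (cases "s = cmod (\<gamma> T')") auto
      then show False using HT' w T'(2) by (simp add: T\<^sub>1_def)
    qed
    moreover have "cmod (f (\<gamma> T')) = T'" using \<gamma>(2)[OF T'' order_refl] e(1) T' T0 by (simp add: norm_mult)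
    ultimately have "\<gamma> T' \<in> Z" using \<gamma>(2)[OF T'' order_refl] HT' T' by (simp add: Z_def)
    then have "T' \<in> I" unfolding I_def using \<open>cmod (f (\<gamma> T')) = T'\<close>[symmetric] by (rule image_eqI[rotated])
    then show False using Tup[of T'] T' by simp
  qed
  have "f z = w" unfolding z(2) \<open>T = T\<^sub>1\<close> T\<^sub>1_def by (rule e(2)[symmetric])
  then show ?thesis using z(1) s by force
qed

lemma infdist_frontier_ge:
  fixes U :: "complex set"
  assumes "open U" "U \<noteq> {}" "U \<noteq> UNIV" "ball 0 L \<subseteq> U"
  shows "L \<le> infdist 0 (frontier U)"
proof -
  have ne: "frontier U \<noteq> {}" using assms by (simp add: frontier_eq_empty)
  have "L \<le> dist 0 x" if "x \<in> frontier U" for x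
  proof (rule ccontr)
    assume "\<not> L \<le> dist 0 x"
    then have "x \<in> U" using assms(4) by auto
    then show False using that assms(1) by (simp add: frontier_def interior_open)
  qed
  then show ?thesis unfolding infdist_notempty[OF ne] by (intro cINF_greatest ne)
qed

section \<open>Taylor coefficients and majorant series\<close>

lemma taylor_sums:
  assumes "f holomorphic_on ball 0 1" "z \<in> ball 0 1"
  shows "(\<lambda>n. fps_nth (fps_expansion f 0) n * z ^ n) sums f z"
  using holomorphic_power_series[OF assms] by (simp add: fps_expansion_def)

lemma has_fps_expansion_disc:
  assumes "f holomorphic_on ball 0 1"
  shows "f has_fps_expansion fps_expansion f 0"
  by (rule has_fps_expansion_fps_expansion[OF open_ball _ assms]) simp

lemma summable_majorant:
  assumes "f holomorphic_on ball 0 1" "0 \<le> r" "r < 1"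
  shows "summable (\<lambda>n. cmod (fps_nth (fps_expansion f 0) n) * r ^ n)"
proof -
  obtain s where s: "r < s" "s < 1" using dense assms(3) by blast
  have "summable (\<lambda>n. fps_nth (fps_expansion f 0) n * of_real s ^ n)"
    using taylor_sums[OF assms(1), of "of_real s"] s assms(2) by (auto simp: sums_iff)
  from powser_insidea[OF this, of "of_real r"] show ?thesis
    using s assms(2) by (simp add: norm_mult norm_power)
qed

lemma majorant_cong:
  assumes "\<And>z. z \<in> ball 0 1 \<Longrightarrow> f z = g z"
  shows "majorant f r = majorant g r"
proof -
  have "\<forall>\<^sub>F z in nhds 0. z \<in> ball (0::complex) 1" by (rule eventually_nhds_in_open) auto
  then have "\<forall>\<^sub>F z in nhds 0. f z = g z" by eventually_elim (rule assms)
  then have "fps_expansion f 0 = fps_expansion g 0" by (rule fps_expansion_cong)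
  then show ?thesis by (simp add: majorant_def)
qed

lemma majorant_nonneg: "0 \<le> r \<Longrightarrow> f holomorphic_on ball 0 1 \<Longrightarrow> r < 1 \<Longrightarrow> 0 \<le> majorant f r"
  unfolding majorant_def by (rule suminf_nonneg[OF summable_majorant]) auto

lemma fps_expansion_mult:
  assumes "f holomorphic_on ball 0 1" "g holomorphic_on ball 0 1"
  shows "fps_expansion (\<lambda>z. f z * g z) 0 = fps_expansion f 0 * fps_expansion g 0"
  by (rule fps_expansion_eqI)
     (intro fps_expansion_intros has_fps_expansion_disc assms)

lemma majorant_mult_le:
  assumes f: "f holomorphic_on ball 0 1" and g: "g holomorphic_on ball 0 1" and r: "0 \<le> r" "r < 1"
  shows "majorant (\<lambda>z. f z * g z) r \<le> majorant f r * majorant g r"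
proof -
  define a where "a n = cmod (fps_nth (fps_expansion f 0) n) * r ^ n" for n
  define b where "b n = cmod (fps_nth (fps_expansion g 0) n) * r ^ n" for n
  have sa: "summable (\<lambda>n. norm (a n))" "summable (\<lambda>n. norm (b n))"
    using summable_majorant[OF f r] summable_majorant[OF g r] r by (simp_all add: a_def b_def)
  have S: "(\<lambda>n. \<Sum>i\<le>n. a i * b (n - i)) sums (majorant f r * majorant g r)"
    using Cauchy_product_sums[OF sa] by (simp add: majorant_def a_def b_def)
  have "majorant (\<lambda>z. f z * g z) r \<le> (\<Sum>n. \<Sum>i\<le>n. a i * b (n - i))"
    unfolding majorant_def
  proof (rule suminf_le)
    show "summable (\<lambda>n. cmod (fps_nth (fps_expansion (\<lambda>z. f z * g z) 0) n) * r ^ n)"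
      by (rule summable_majorant) (intro holomorphic_intros f g, use r in auto)
    show "summable (\<lambda>n. \<Sum>i\<le>n. a i * b (n - i))" using S by (simp add: sums_iff)
    fix n
    have "cmod (fps_nth (fps_expansion (\<lambda>z. f z * g z) 0) n) * r ^ n
        = cmod (\<Sum>i\<le>n. fps_nth (fps_expansion f 0) i * fps_nth (fps_expansion g 0) (n - i)) * r ^ n"
      by (simp add: fps_expansion_mult[OF f g] fps_mult_nth atMost_atLeast0)
    also have "\<dots> \<le> (\<Sum>i\<le>n. cmod (fps_nth (fps_expansion f 0) i * fps_nth (fps_expansion g 0) (n - i))) * r ^ n"
      using r by (intro mult_right_mono norm_sum) auto
    also have "\<dots> = (\<Sum>i\<le>n. a i * b (n - i))"
      unfolding sum_distrib_right
    proof (rule sum.cong)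
      fix i assume "i \<in> {..n}"
      then have "r ^ n = r ^ i * r ^ (n - i)" by (simp add: power_add[symmetric])
      then show "cmod (fps_nth (fps_expansion f 0) i * fps_nth (fps_expansion g 0) (n - i)) * r ^ n = a i * b (n - i)"
        by (simp add: a_def b_def norm_mult)
    qed simp
    finally show "cmod (fps_nth (fps_expansion (\<lambda>z. f z * g z) 0) n) * r ^ n \<le> (\<Sum>i\<le>n. a i * b (n - i))" .
  qed
  also have "\<dots> = majorant f r * majorant g r" using S by (simp add: sums_iff)
  finally show ?thesis .
qed

lemma fps_expansion_power_times:
  assumes "u holomorphic_on ball 0 1"
  shows "fps_expansion (\<lambda>z. z ^ k * u z) 0 = fps_X ^ k * fps_expansion u 0"
  by (rule fps_expansion_eqI)
     (intro has_fps_expansion_mult has_fps_expansion_fps_X_power has_fps_expansion_disc assms)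

lemma majorant_times_z:
  assumes u: "u holomorphic_on ball 0 1" and r: "0 \<le> r" "r < 1"
  shows "majorant (\<lambda>z. z ^ k * u z) r = r ^ k * majorant u r"
proof -
  define c where "c = fps_nth (fps_expansion (\<lambda>z. z ^ k * u z) 0)"
  have c: "c n = (if n < k then 0 else fps_nth (fps_expansion u 0) (n - k))" for n
    by (simp add: c_def fps_expansion_power_times[OF u] fps_X_power_mult_nth)
  have "(\<lambda>n. cmod (c (n + k)) * r ^ (n + k)) sums (r ^ k * majorant u r)"
    using sums_mult[OF summable_sums[OF summable_majorant[OF u r]], of "r ^ k"]
    by (simp add: c majorant_def power_add mult_ac)
  then have "(\<lambda>n. cmod (c n) * r ^ n) sums (r ^ k * majorant u r)"
    by (subst sums_zero_iff_shift[symmetric, where n = k]) (simp_all add: c)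
  then show ?thesis by (simp add: majorant_def c_def sums_iff)
qed

text \<open>Caratheodory's coefficient bound: for \<open>n > 0\<close> the function \<open>cnj p\<close> has no Fourier coefficient of index
  \<open>n\<close>, so \<open>p\<close> may be replaced by \<open>2 * Re p\<close>, whose absolute value integrates to its mean.\<close>
lemma Re_nonneg_taylor_coefficient_bound:
  assumes p: "p holomorphic_on ball 0 1" and re: "\<And>z. z \<in> ball 0 1 \<Longrightarrow> Re (p z) \<ge> 0" and n: "n > 0"
  shows "cmod (fps_nth (fps_expansion p 0) n) \<le> 2 * Re (p 0)"
proof -
  define c where "c m = fps_nth (fps_expansion p 0) m" for m
  have bound: "cmod (c n) * \<rho> ^ n \<le> 2 * Re (p 0)" if \<rho>: "0 < \<rho>" "\<rho> < 1" for \<rho> :: real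
  proof -
    have contp: "continuous_on (cball 0 \<rho>) p" and holp: "p holomorphic_on ball 0 \<rho>"
      using \<rho> by (auto intro!: holomorphic_on_imp_continuous_on[OF holomorphic_on_subset[OF p]] holomorphic_on_subset[OF p])
    have fourier: "((\<lambda>t. p (of_real \<rho> * cis t) * cis (- (real m * t))) has_integral 2 * pi * c m * of_real \<rho> ^ m) {0..2*pi}" for m
    proof -
      have "((\<lambda>u. p u / (u - 0) ^ Suc m) has_contour_integral (2 * pi * \<i>) / fact m * (deriv ^^ m) p 0) (part_circlepath 0 \<rho> 0 (2*pi))"
        using Cauchy_has_contour_integral_higher_derivative_circlepath[OF contp holp, of 0 m] \<rho>
        by (simp add: circlepath_def)
      then have "((\<lambda>t. p (of_real \<rho> * cis t) / (of_real \<rho> * cis t) ^ Suc m * of_real \<rho> * \<i> * cis t) has_integral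
                  (2 * pi * \<i>) * c m) {0..2*pi}"
        by (subst (asm) has_contour_integral_part_circlepath_iff) (simp_all add: c_def fps_expansion_def)
      from has_integral_mult_right[OF this, of "- \<i> * of_real \<rho> ^ m"]
      have z: "((\<lambda>t. - \<i> * of_real \<rho> ^ m * (p (of_real \<rho> * cis t) / (of_real \<rho> * cis t) ^ Suc m * of_real \<rho> * \<i> * cis t))
                 has_integral 2 * pi * c m * of_real \<rho> ^ m) {0..2*pi}"
        by (simp add: mult_ac)
      show ?thesis
      proof (rule has_integral_eq[OF _ z])
        fix t :: real
        have C: "(of_real \<rho> * cis t) ^ Suc m = of_real \<rho> ^ m * cis (real m * t) * (of_real \<rho> * cis t)"
          by (simp only: power_Suc2 power_mult_distrib Complex.DeMoivre)
        have "cis (- (real m * t)) = 1 / cis (real m * t)"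
          by (simp add: cis_inverse[symmetric] inverse_eq_divide del: cis_inverse)
        then show "- \<i> * of_real \<rho> ^ m * (p (of_real \<rho> * cis t) / (of_real \<rho> * cis t) ^ Suc m * of_real \<rho> * \<i> * cis t)
                   = p (of_real \<rho> * cis t) * cis (- (real m * t))"
          unfolding C using \<rho> by (simp add: field_simps Complex.DeMoivre)
      qed
    qed
    have zero: "((\<lambda>t. p (of_real \<rho> * cis t) * cis (real n * t)) has_integral 0) {0..2*pi}"
    proof -
      have "((\<lambda>u. p u * u ^ (n - 1)) has_contour_integral 0) (circlepath 0 \<rho>)"
        by (rule Cauchy_theorem_disc_simple[where a = 0 and e = 1])
           (use \<rho> p in \<open>auto intro!: holomorphic_intros\<close>)
      then have "((\<lambda>t. p (of_real \<rho> * cis t) * (of_real \<rho> * cis t) ^ (n - 1) * of_real \<rho> * \<i> * cis t) has_integral 0) {0..2*pi}"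
        unfolding circlepath_def by (subst (asm) has_contour_integral_part_circlepath_iff) simp_all
      from has_integral_mult_right[OF this, of "- \<i> / of_real \<rho> ^ n"]
      have z: "((\<lambda>t. - \<i> / of_real \<rho> ^ n * (p (of_real \<rho> * cis t) * (of_real \<rho> * cis t) ^ (n - 1) * of_real \<rho> * \<i> * cis t)) has_integral 0) {0..2*pi}"
        by simp
      obtain n' where n': "n = Suc n'" using n by (cases n) auto
      show ?thesis
        by (rule has_integral_eq[OF _ z])
           (use \<rho> in \<open>simp add: n' power_mult_distrib Complex.DeMoivre cis_mult[symmetric] ring_distribs field_simps\<close>)
    qed
    have conj: "((\<lambda>t. cnj (p (of_real \<rho> * cis t)) * cis (- (real n * t))) has_integral 0) {0..2*pi}"
      using has_integral_linear[OF zero bounded_linear_cnj] by (simp add: o_def cis_cnj)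
    have sum: "((\<lambda>t. of_real (2 * Re (p (of_real \<rho> * cis t))) * cis (- (real n * t))) has_integral 2 * pi * c n * of_real \<rho> ^ n) {0..2*pi}"
      using has_integral_add[OF fourier[of n] conj]
      by (simp add: distrib_right[symmetric] complex_add_cnj)
    have re0: "((\<lambda>t. 2 * Re (p (of_real \<rho> * cis t))) has_integral 2 * (2 * pi * Re (p 0))) {0..2*pi}"
      using has_integral_mult_right[OF has_integral_linear[OF fourier[of 0] bounded_linear_Re], of 2]
      by (simp add: o_def c_def fps_expansion_def)
    have "cmod (integral {0..2*pi} (\<lambda>t. of_real (2 * Re (p (of_real \<rho> * cis t))) * cis (- (real n * t))))
          \<le> integral {0..2*pi} (\<lambda>t. 2 * Re (p (of_real \<rho> * cis t)))"
    proof (rule integral_norm_bound_integral)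
      fix t :: real
      have "Re (p (of_real \<rho> * cis t)) \<ge> 0" by (rule re) (use \<rho> in \<open>simp add: norm_mult\<close>)
      then show "cmod (of_real (2 * Re (p (of_real \<rho> * cis t))) * cis (- (real n * t))) \<le> 2 * Re (p (of_real \<rho> * cis t))"
        by (simp add: norm_mult)
    qed (use sum re0 in \<open>auto simp: integrable_on_def\<close>)
    then have "cmod (2 * pi * c n * of_real \<rho> ^ n) \<le> 2 * (2 * pi * Re (p 0))"
      unfolding integral_unique[OF sum] integral_unique[OF re0] .
    then show ?thesis using \<rho> by (simp add: norm_mult norm_power mult.commute)
  qed
  have "((\<lambda>\<rho>::real. cmod (c n) * \<rho> ^ n) \<longlongrightarrow> cmod (c n) * 1 ^ n) (at_left 1)"
    by (intro tendsto_intros)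
  then have "cmod (c n) * 1 ^ n \<le> 2 * Re (p 0)"
  proof (rule tendsto_upperbound)
    have "\<forall>\<^sub>F \<rho> in at_left (1::real). \<rho> \<in> {0<..<1}" by (rule eventually_at_left_real) simp
    then show "\<forall>\<^sub>F \<rho> in at_left 1. cmod (c n) * \<rho> ^ n \<le> 2 * Re (p 0)" by eventually_elim (use bound in auto)
  qed simp
  then show ?thesis by (simp add: c_def)
qed

text \<open>After a rotation \<open>1 - \<alpha> * v\<close> has nonnegative real part, so all later coefficients are at most
  \<open>2 * (1 - \<bar>v 0\<bar>)\<close>. At \<open>r = 1/3\<close> the geometric series sums to exactly \<open>1/2\<close>.\<close>
lemma Bohr_inequality:
  assumes v: "v holomorphic_on ball 0 1" and le: "\<And>z. z \<in> ball 0 1 \<Longrightarrow> cmod (v z) \<le> 1"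
    and r: "0 \<le> r" "r \<le> 1/3"
  shows "majorant v r \<le> 1"
proof -
  define b where "b = cmod (v 0)"
  obtain \<alpha> where \<alpha>: "cmod \<alpha> = 1" "\<alpha> * v 0 = of_real b"
  proof (cases "v 0 = 0")
    case True then show ?thesis using that[of 1] by (simp add: b_def)
  next
    case False then show ?thesis
      using that[of "of_real b / v 0"] by (simp add: b_def norm_divide)
  qed
  define p where "p z = 1 - \<alpha> * v z" for z
  have holp: "p holomorphic_on ball 0 1" unfolding p_def by (intro holomorphic_intros v)
  have rep: "Re (p z) \<ge> 0" if "z \<in> ball 0 1" for z
    using complex_Re_le_cmod[of "\<alpha> * v z"] le[OF that] \<alpha>(1) by (simp add: p_def norm_mult)
  have "fps_expansion p 0 = 1 - fps_const \<alpha> * fps_expansion v 0"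
    unfolding p_def by (rule fps_expansion_eqI) (intro fps_expansion_intros has_fps_expansion_disc v)
  then have pn: "fps_nth (fps_expansion p 0) n = - \<alpha> * fps_nth (fps_expansion v 0) n" if "n > 0" for n
    using that by simp
  have bn: "cmod (fps_nth (fps_expansion v 0) n) \<le> 2 * (1 - b)" if "n > 0" for n
  proof -
    have "cmod (fps_nth (fps_expansion p 0) n) = cmod (fps_nth (fps_expansion v 0) n)"
      unfolding pn[OF that] using \<alpha>(1) by (simp add: norm_mult)
    moreover have "Re (p 0) = 1 - b" using \<alpha>(2) by (simp add: p_def)
    ultimately show ?thesis using Re_nonneg_taylor_coefficient_bound[OF holp rep that] by simp
  qed
  have b1: "b \<le> 1" using le[of 0] by (simp add: b_def)
  define s where "s n = (if n = 0 then b else 2 * (1 - b) * (1/3) ^ n)" for n :: nat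
  have "(\<lambda>n. 2 * (1 - b) / 3 * (1/3) ^ n) sums (2 * (1 - b) / 3 * (1 / (1 - 1/3)))"
    by (intro sums_mult geometric_sums) auto
  moreover have "2 * (1 - b) / 3 * (1 / (1 - 1/3)) = 1 - b" by (simp add: field_simps)
  moreover have "(\<lambda>n. s (Suc n)) = (\<lambda>n. 2 * (1 - b) / 3 * (1/3) ^ n)" by (simp add: s_def fun_eq_iff)
  ultimately have "(\<lambda>n. s (Suc n)) sums (1 - b)" by (simp only:)
  then have S: "s sums 1" using sums_Suc[of s "1 - b"] by (simp add: s_def)
  have "majorant v r \<le> (\<Sum>n. s n)"
    unfolding majorant_def
  proof (rule suminf_le)
    show "summable (\<lambda>n. cmod (fps_nth (fps_expansion v 0) n) * r ^ n)" by (rule summable_majorant[OF v r(1)]) (use r in simp)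
    show "summable s" using S by (simp add: sums_iff)
    fix n
    show "cmod (fps_nth (fps_expansion v 0) n) * r ^ n \<le> s n"
    proof (cases "n = 0")
      case True then show ?thesis by (simp add: s_def b_def fps_expansion_def)
    next
      case False
      then have "cmod (fps_nth (fps_expansion v 0) n) * r ^ n \<le> 2 * (1 - b) * (1/3) ^ n"
        using bn[of n] b1 r by (intro mult_mono power_mono) auto
      then show ?thesis using False by (simp add: s_def)
    qed
  qed
  then show ?thesis using S by (simp add: sums_iff)
qed

text \<open>Bohr's inequality applies to \<open>v ^ i\<close> in the factorization \<open>\<omega> z = z * v z\<close>.\<close>
lemma majorant_power_schwarz:
  assumes \<omega>: "\<omega> holomorphic_on ball 0 1" "\<omega> 0 = 0" "\<omega> ` ball 0 1 \<subseteq> ball 0 1" and r: "0 \<le> r" "r \<le> 1/3"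
  shows "majorant (\<lambda>z. \<omega> z ^ i) r \<le> r ^ i"
proof -
  have lt: "cmod (\<omega> z) < 1" if "cmod z < 1" for z
  proof -
    have "\<omega> z \<in> \<omega> ` ball 0 1" using that by (intro imageI) simp
    then have "\<omega> z \<in> ball 0 1" using \<omega>(3) by blast
    then show ?thesis by simp
  qed
  obtain v where v: "v holomorphic_on ball 0 1" "\<And>z. cmod z < 1 \<Longrightarrow> \<omega> z = z * v z" "deriv \<omega> 0 = v 0"
    by (rule Schwarz3[OF \<omega>(1,2)]) blast
  have vle: "cmod (v z) \<le> 1" if "z \<in> ball 0 1" for z
  proof (cases "z = 0")
    case True then show ?thesis using Schwarz_Lemma(2)[OF \<omega>(1,2) lt, of 0] v(3) by simp
  next
    case False
    have "cmod (\<omega> z) \<le> cmod z" by (rule Schwarz_Lemma(1)[OF \<omega>(1,2) lt]) (use that in auto)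
    then show ?thesis using v(2)[of z] that False by (simp add: norm_mult)
  qed
  have "majorant (\<lambda>z. \<omega> z ^ i) r = majorant (\<lambda>z. z ^ i * v z ^ i) r"
    by (rule majorant_cong) (simp add: v(2) power_mult_distrib)
  also have "\<dots> = r ^ i * majorant (\<lambda>z. v z ^ i) r"
    by (rule majorant_times_z) (use r in \<open>auto intro!: holomorphic_intros v(1)\<close>)
  also have "\<dots> \<le> r ^ i * 1"
    by (intro mult_left_mono Bohr_inequality holomorphic_intros v(1))
       (use vle r in \<open>auto simp: norm_power intro!: power_le_one\<close>)
  finally show ?thesis by simp
qed

text \<open>Expand \<open>F \<circ> \<omega>\<close> in powers of \<open>\<omega>\<close>. Each Taylor coefficient involves only finitely many powers because
  \<open>\<omega> 0 = 0\<close>, so it is enough to compare partial sums.\<close>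
lemma majorant_subordinate_le:
  assumes F: "F holomorphic_on ball 0 1"
    and \<omega>: "\<omega> holomorphic_on ball 0 1" "\<omega> 0 = 0" "\<omega> ` ball 0 1 \<subseteq> ball 0 1" and r: "0 \<le> r" "r \<le> 1/3"
  shows "majorant (\<lambda>z. F (\<omega> z)) r \<le> majorant F r"
proof -
  define W where "W = fps_expansion \<omega> 0"
  have holF\<omega>: "(\<lambda>z. F (\<omega> z)) holomorphic_on ball 0 1"
    by (rule holomorphic_on_compose_gen[OF \<omega>(1) F \<omega>(3), unfolded o_def])
  have "(F \<circ> \<omega>) has_fps_expansion fps_compose (fps_expansion F 0) W"
    unfolding W_def
    by (intro has_fps_expansion_compose has_fps_expansion_disc F \<omega>(1)) (simp add: fps_expansion_def \<omega>(2))
  then have comp: "fps_expansion (\<lambda>z. F (\<omega> z)) 0 = fps_compose (fps_expansion F 0) W"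
    using fps_expansion_eqI by (simp add: o_def)
  have pow: "fps_expansion (\<lambda>z. \<omega> z ^ i) 0 = W ^ i" for i
    unfolding W_def by (rule fps_expansion_eqI) (intro has_fps_expansion_power has_fps_expansion_disc \<omega>)
  have r1: "r < 1" using r by simp
  have W: "(\<Sum>m<N. cmod (fps_nth (W ^ i) m) * r ^ m) \<le> r ^ i" for N i
  proof -
    have "(\<Sum>m<N. cmod (fps_nth (W ^ i) m) * r ^ m) \<le> majorant (\<lambda>z. \<omega> z ^ i) r"
      unfolding majorant_def pow[symmetric]
      by (intro sum_le_suminf summable_majorant holomorphic_intros \<omega>(1)) (use r r1 in auto)
    also have "\<dots> \<le> r ^ i" by (rule majorant_power_schwarz[OF \<omega> r])
    finally show ?thesis .
  qed
  show ?thesis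
    unfolding majorant_def
  proof (rule suminf_le_const[OF summable_majorant[OF holF\<omega> r(1) r1]])
    fix N
    have "(\<Sum>m<N. cmod (fps_nth (fps_expansion (\<lambda>z. F (\<omega> z)) 0) m) * r ^ m)
        \<le> (\<Sum>m<N. \<Sum>i<N. cmod (fps_nth (fps_expansion F 0) i) * (cmod (fps_nth (W ^ i) m) * r ^ m))"
    proof (rule sum_mono)
      fix m assume m: "m \<in> {..<N}"
      have "cmod (fps_nth (fps_expansion (\<lambda>z. F (\<omega> z)) 0) m) * r ^ m
          \<le> (\<Sum>i=0..m. cmod (fps_nth (fps_expansion F 0) i * fps_nth (W ^ i) m)) * r ^ m"
        unfolding comp fps_compose_nth using r by (intro mult_right_mono norm_sum) auto
      also have "\<dots> = (\<Sum>i=0..m. cmod (fps_nth (fps_expansion F 0) i) * (cmod (fps_nth (W ^ i) m) * r ^ m))"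
        by (simp add: sum_distrib_right norm_mult mult.assoc)
      also have "\<dots> \<le> (\<Sum>i<N. cmod (fps_nth (fps_expansion F 0) i) * (cmod (fps_nth (W ^ i) m) * r ^ m))"
        by (rule sum_mono2) (use m r in auto)
      finally show "cmod (fps_nth (fps_expansion (\<lambda>z. F (\<omega> z)) 0) m) * r ^ m
          \<le> (\<Sum>i<N. cmod (fps_nth (fps_expansion F 0) i) * (cmod (fps_nth (W ^ i) m) * r ^ m))" .
    qed
    also have "\<dots> = (\<Sum>i<N. cmod (fps_nth (fps_expansion F 0) i) * (\<Sum>m<N. cmod (fps_nth (W ^ i) m) * r ^ m))"
      by (subst sum.swap) (simp add: sum_distrib_left)
    also have "\<dots> \<le> (\<Sum>i<N. cmod (fps_nth (fps_expansion F 0) i) * r ^ i)"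
      by (intro sum_mono mult_left_mono W) auto
    also have "\<dots> \<le> (\<Sum>i. cmod (fps_nth (fps_expansion F 0) i) * r ^ i)"
      by (intro sum_le_suminf summable_majorant[OF F r(1) r1]) (use r in auto)
    finally show "(\<Sum>m<N. cmod (fps_nth (fps_expansion (\<lambda>z. F (\<omega> z)) 0) m) * r ^ m)
        \<le> (\<Sum>i. cmod (fps_nth (fps_expansion F 0) i) * r ^ i)" .
  qed
qed

lemma majorant_has_derivative:
  assumes f: "f holomorphic_on ball 0 1" and x: "\<bar>x\<bar> < 1"
  shows "(majorant f has_real_derivative
           (\<Sum>n. diffs (\<lambda>n. cmod (fps_nth (fps_expansion f 0) n)) n * x ^ n)) (at x)"
proof -
  obtain s where s: "\<bar>x\<bar> < s" "s < 1" using dense x by blast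
  have "summable (\<lambda>n. cmod (fps_nth (fps_expansion f 0) n) * s ^ n)"
    by (rule summable_majorant[OF f]) (use s in auto)
  from termdiffs_strong[OF this, of x] s show ?thesis unfolding majorant_def[abs_def] by simp
qed

lemma majorant_derivative_times:
  assumes f: "f holomorphic_on ball 0 1" and x: "0 \<le> x" "x < 1"
  shows "x * (\<Sum>n. diffs (\<lambda>n. cmod (fps_nth (fps_expansion f 0) n)) n * x ^ n) = majorant (\<lambda>z. z * deriv f z) x"
proof -
  have hz: "(\<lambda>z. z * deriv f z) holomorphic_on ball 0 1" by (intro holomorphic_intros f) auto
  have "fps_expansion (\<lambda>z. z * deriv f z) 0 = fps_X * fps_deriv (fps_expansion f 0)"
    by (rule fps_expansion_eqI) (intro fps_expansion_intros has_fps_expansion_disc f)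
  then have nth: "fps_nth (fps_expansion (\<lambda>z. z * deriv f z) 0) n = of_nat n * fps_nth (fps_expansion f 0) n" for n
    by (cases n) auto
  have "(\<lambda>n. cmod (fps_nth (fps_expansion (\<lambda>z. z * deriv f z) 0) n) * x ^ n) sums majorant (\<lambda>z. z * deriv f z) x"
    unfolding majorant_def by (rule summable_sums[OF summable_majorant[OF hz x]])
  then have "(\<lambda>n. cmod (fps_nth (fps_expansion (\<lambda>z. z * deriv f z) 0) (Suc n)) * x ^ Suc n) sums majorant (\<lambda>z. z * deriv f z) x"
    by (subst sums_Suc_iff) (simp add: nth)
  then have A: "(\<lambda>n. x * (diffs (\<lambda>n. cmod (fps_nth (fps_expansion f 0) n)) n * x ^ n)) sums majorant (\<lambda>z. z * deriv f z) x"
    by (simp add: nth diffs_def norm_mult mult_ac del: of_nat_Suc)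
  show ?thesis
  proof (cases "x = 0")
    case True
    then show ?thesis using A by (simp add: sums_iff)
  next
    case False
    then have "summable (\<lambda>n. diffs (\<lambda>n. cmod (fps_nth (fps_expansion f 0) n)) n * x ^ n)"
      by (rule summable_mult_D[OF sums_summable[OF A]])
    then show ?thesis using A by (simp add: sums_iff suminf_mult)
  qed
qed

lemma normalized_expansion_taylor:
  assumes "normalized_expansion f a"
  shows "fps_expansion f 0 = Abs_fps (\<lambda>n. if n = 0 then 0 else if n = 1 then 1 else a n)"
    and "f 0 = 0" and "deriv f 0 = 1"
proof -
  define b where "b n = (if n = 0 then 0 else if n = 1 then 1 else a n)" for n :: nat
  have S: "(\<lambda>n. b n * z ^ n) sums f z" if "z \<in> ball 0 1" for z
  proof -
    have "(\<lambda>n. a (n + 2) * z ^ (n + 2)) sums (f z - z)" using assms that unfolding normalized_expansion_def by blast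
    then have "(\<lambda>n. b (n + 2) * z ^ (n + 2)) sums (f z - (\<Sum>i<2. b i * z ^ i))" by (simp add: b_def numeral_2_eq_2)
    then show ?thesis by (subst (asm) sums_iff_shift') 
  qed
  have "f has_fps_expansion Abs_fps b"
    unfolding has_fps_expansion_def
  proof
    have "summable (\<lambda>n. b n * (1/2) ^ n)" using S[of "1/2"] by (auto simp: sums_iff)
    then have "conv_radius b \<ge> norm (1/2 :: complex)" by (rule conv_radius_geI)
    then show "fps_conv_radius (Abs_fps b) > 0" by (simp add: fps_conv_radius_def) (metis ereal_less(2) half_gt_zero_iff less_le_trans zero_less_one)
    have "\<forall>\<^sub>F z in nhds 0. z \<in> ball (0::complex) 1" by (rule eventually_nhds_in_open) auto
    then show "\<forall>\<^sub>F z in nhds 0. eval_fps (Abs_fps b) z = f z"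
      by eventually_elim (use S in \<open>simp add: eval_fps_def sums_iff\<close>)
  qed
  from fps_expansion_eqI[OF this] show eq: "fps_expansion f 0 = Abs_fps (\<lambda>n. if n = 0 then 0 else if n = 1 then 1 else a n)"
    by (simp add: b_def[abs_def])
  show "f 0 = 0" using arg_cong[OF eq, of "\<lambda>F. fps_nth F 0"] by (simp add: fps_expansion_def)
  show "deriv f 0 = 1" using arg_cong[OF eq, of "\<lambda>F. fps_nth F 1"] by (simp add: fps_expansion_def)
qed

section \<open>Primitives of the radial derivative and reflection\<close>

lemma vanishing_radial_derivative:
  assumes hol: "v holomorphic_on ball 0 1" and d: "\<And>z. z \<in> ball 0 1 \<Longrightarrow> z * deriv v z = 0" and z: "z \<in> ball 0 1"
  shows "v z = v 0"
proof -
  have "v constant_on ball 0 1"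
  proof (rule DERIV_zero_connected_constant_on)
    show "\<forall>x\<in>ball 0 1 - {0}. (v has_field_derivative 0) (at x)"
    proof
      fix x :: complex assume x: "x \<in> ball 0 1 - {0}"
      then have "deriv v x = 0" using d[of x] by auto
      then show "(v has_field_derivative 0) (at x)" using holomorphic_derivI[OF hol open_ball, of x UNIV] x by simp
    qed
  qed (use hol holomorphic_on_imp_continuous_on in auto)
  then obtain c where "\<And>x. x \<in> ball 0 1 \<Longrightarrow> v x = c" unfolding constant_on_def by blast
  then show ?thesis using z by simp
qed

lemma radial_primitive_exists:
  assumes hol: "Q holomorphic_on ball 0 1" and Q0: "Q 0 = 0"
  obtains A where "A holomorphic_on ball 0 1" "A 0 = 0" "\<And>z. z \<in> ball 0 1 \<Longrightarrow> z * deriv A z = Q z"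
    "deriv A 0 = deriv Q 0"
proof -
  define R where "R = (\<lambda>z. if z = 0 then deriv Q 0 else (Q z - Q 0) / (z - 0))"
  have "R holomorphic_on ball 0 1" unfolding R_def by (rule pole_lemma_open[OF hol open_ball])
  then obtain g where g: "\<And>x. x \<in> ball 0 1 \<Longrightarrow> (g has_field_derivative R x) (at x within ball 0 1)"
    using holomorphic_convex_primitive'[OF convex_ball open_ball] by blast
  define A where "A z = g z - g 0" for z
  have A: "(A has_field_derivative R z) (at z)" if "z \<in> ball 0 1" for z
    unfolding A_def using g[OF that] that by (auto intro!: derivative_eq_intros simp: at_within_open[OF that])
  have dA: "deriv A z = R z" if "z \<in> ball 0 1" for z by (rule DERIV_imp_deriv[OF A[OF that]])
  show ?thesis
  proof (rule that[of A])
    show "A holomorphic_on ball 0 1" using A holomorphic_on_open[OF open_ball] by blast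
    show "z * deriv A z = Q z" if "z \<in> ball 0 1" for z using dA[OF that] Q0 by (simp add: R_def)
    show "deriv A 0 = deriv Q 0" using dA[of 0] by (simp add: R_def)
  qed (simp add: A_def)
qed

text \<open>The function \<open>(h z / z) * exp (- A z)\<close> has vanishing derivative.\<close>
lemma eq_times_exp_radial_primitive:
  assumes holh: "h holomorphic_on ball 0 1" and h0: "h 0 = 0" and dh0: "deriv h 0 = 1"
    and lg: "\<And>z. z \<in> ball 0 1 - {0} \<Longrightarrow> h z \<noteq> 0 \<and> z * deriv h z / h z = 1 + z * deriv A z"
    and holA: "A holomorphic_on ball 0 1" and A0: "A 0 = 0" and z: "z \<in> ball 0 1"
  shows "h z = z * exp (A z)"
proof -
  define u where "u = (\<lambda>z. if z = 0 then deriv h 0 else (h z - h 0) / (z - 0))"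
  have holu: "u holomorphic_on ball 0 1" unfolding u_def by (rule pole_lemma_open[OF holh open_ball])
  have hu: "h x = x * u x" for x by (simp add: u_def h0)
  have du: "(u has_field_derivative deriv u x) (at x)" "(A has_field_derivative deriv A x) (at x)" if "x \<in> ball 0 1" for x
    using holomorphic_derivI[OF holu open_ball that] holomorphic_derivI[OF holA open_ball that] by auto
  define v where "v x = u x * exp (- A x)" for x
  have "v z = v 0"
  proof (rule vanishing_radial_derivative[OF _ _ z])
    show "v holomorphic_on ball 0 1" unfolding v_def by (intro holomorphic_intros holu holA)
    fix x :: complex assume x: "x \<in> ball 0 1"
    have dv: "deriv v x = (deriv u x - u x * deriv A x) * exp (- A x)"
      unfolding v_def by (rule DERIV_imp_deriv) (auto intro!: derivative_eq_intros du x simp: algebra_simps)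
    show "x * deriv v x = 0"
    proof (cases "x = 0")
      case False
      have "deriv h x = u x + x * deriv u x"
        unfolding hu[abs_def] by (rule DERIV_imp_deriv) (auto intro!: derivative_eq_intros du x)
      moreover have "h x \<noteq> 0 \<and> x * deriv h x / h x = 1 + x * deriv A x" using lg x False by auto
      ultimately have "u x \<noteq> 0" "u x + x * deriv u x = u x * (1 + x * deriv A x)"
        using False by (auto simp: hu field_simps)
      then have "x * deriv u x = u x * (x * deriv A x)" by (simp add: algebra_simps)
      then show ?thesis unfolding dv by (simp add: algebra_simps)
    qed simp
  qed
  also have "\<dots> = 1" by (simp add: v_def A0 u_def dh0)
  finally have "u z = exp (A z)" by (simp add: v_def exp_minus field_simps)
  then show ?thesis by (simp add: hu)
qed

lemma holomorphic_on_reflect: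
  assumes "f holomorphic_on ball 0 1"
  shows "(\<lambda>z. cnj (f (cnj z))) holomorphic_on ball 0 1"
    and "z \<in> ball 0 1 \<Longrightarrow> deriv (\<lambda>z. cnj (f (cnj z))) z = cnj (deriv f (cnj z))"
proof -
  have "x \<in> cnj ` ball 0 1" if "x \<in> ball 0 1" for x
    by (rule image_eqI[of _ _ "cnj x"]) (use that in simp_all)
  then have "cnj ` ball 0 1 = ball 0 1" by auto
  then show "(\<lambda>z. cnj (f (cnj z))) holomorphic_on ball 0 1"
    using holomorphic_on_compose_cnj_cnj[of f "ball 0 1"] assms by (simp add: o_def)
  assume z: "z \<in> ball 0 1"
  have "(f has_field_derivative deriv f (cnj z)) (at (cnj z))"
    by (rule holomorphic_derivI[OF assms open_ball]) (use z in simp)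
  from has_field_derivative_cnj_cnj[OF this]
  show "deriv (\<lambda>z. cnj (f (cnj z))) z = cnj (deriv f (cnj z))"
    by (intro DERIV_imp_deriv) (simp add: o_def)
qed

lemma real_on_reals_imp_reflection:
  assumes hol: "f holomorphic_on ball 0 1" and re: "\<And>r::real. 0 < r \<Longrightarrow> r < 1 \<Longrightarrow> f (of_real r) \<in> \<real>"
    and z: "z \<in> ball 0 1"
  shows "cnj (f (cnj z)) = f z"
proof -
  define U where "U = complex_of_real ` {0<..<1}"
  have "cnj (f (cnj z)) - f z = 0"
  proof (rule analytic_continuation[where f = "\<lambda>z. cnj (f (cnj z)) - f z" and S = "ball 0 1" and U = U and \<xi> = 0])
    show "(\<lambda>z. cnj (f (cnj z)) - f z) holomorphic_on ball 0 1"
      by (intro holomorphic_intros holomorphic_on_reflect hol)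
    show "0 islimpt U"
      unfolding islimpt_approachable
    proof (intro allI impI)
      fix e :: real assume "e > 0"
      define r where "r = min (e / 2) (1 / 2)"
      have "0 < r" "r < e" "r < 1" using \<open>e > 0\<close> by (auto simp: r_def)
      then show "\<exists>x'\<in>U. x' \<noteq> 0 \<and> dist x' 0 < e"
        unfolding U_def by (intro bexI[of _ "of_real r"]) auto
    qed
    fix x assume "x \<in> U"
    then show "cnj (f (cnj x)) - f x = 0" using re by (auto simp: U_def Reals_cnj_iff)
  qed (use z in \<open>auto simp: U_def\<close>)
  then show ?thesis by simp
qed


section \<open>The convex function attached to a Ma-Minda function\<close>

text \<open>The minimum condition makes \<open>\<phi>\<close> real on the axis and identifies \<open>- h (- 1)\<close> as the extremal distance.\<close>
locale ma_minda_minimum =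
  fixes \<phi> :: "complex \<Rightarrow> complex"
  assumes mm: "ma_minda \<phi>"
    and min_modulus: "\<And>r::real. 0 < r \<Longrightarrow> r < 1 \<Longrightarrow>
           complex_of_real (INF z\<in>sphere 0 r. cmod (\<phi> z)) = \<phi> (- complex_of_real r)"
begin

lemma \<phi>_holomorphic: "\<phi> holomorphic_on ball 0 1" and \<phi>_injective: "inj_on \<phi> (ball 0 1)" and \<phi>0: "\<phi> 0 = 1"
  and d\<phi>0: "deriv \<phi> 0 \<noteq> 0"
  using mm unfolding ma_minda_def by auto

lemma Re\<phi>:
  assumes "z \<in> ball 0 1"
  shows "Re (\<phi> z) > 0"
proof -
  have "\<phi> ` ball 0 1 \<subseteq> {w. Re w > 0}" using mm unfolding ma_minda_def by blast
  then show ?thesis using assms by blast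
qed

lemma real_neg: "0 < r \<Longrightarrow> r < 1 \<Longrightarrow> \<phi> (- complex_of_real r) = of_real (Re (\<phi> (- complex_of_real r)))"
  using min_modulus[of r] by (metis Re_complex_of_real)

text \<open>The identity theorem, starting from the real values on the negative axis.\<close>
lemma reflect\<phi>:
  assumes "z \<in> ball 0 1"
  shows "cnj (\<phi> (cnj z)) = \<phi> z"
proof -
  have "cnj (\<phi> (- cnj (- z))) = \<phi> (- (- z))"
  proof (rule real_on_reals_imp_reflection[where f = "\<lambda>z. \<phi> (- z)"])
    show "(\<lambda>z. \<phi> (- z)) holomorphic_on ball 0 1"
      by (rule holomorphic_on_compose_gen[OF _ \<phi>_holomorphic, unfolded o_def]) (auto intro!: holomorphic_intros)
    show "\<phi> (- of_real r) \<in> \<real>" if "0 < r" "r < 1" for r using real_neg[OF that] by (metis Reals_of_real)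
  qed (use assms in simp)
  then show ?thesis by simp
qed

text \<open>The maximum principle for \<open>1 / \<phi>\<close>.\<close>
lemma modulus_lower_bound:
  assumes r: "0 < r" "r < 1" and w: "cmod w \<le> r"
  shows "Re (\<phi> (- of_real r)) \<le> cmod (\<phi> w)"
proof -
  define m where "m = Re (\<phi> (- of_real r))"
  have m: "m > 0" unfolding m_def by (rule Re\<phi>) (use r in simp)
  have nz: "\<phi> z \<noteq> 0" if "z \<in> ball 0 1" for z using Re\<phi>[OF that] by auto
  have "(INF z\<in>sphere 0 r. cmod (\<phi> z)) = m"
    using min_modulus[OF r] by (metis m_def Re_complex_of_real)
  moreover have "bdd_below ((\<lambda>z. cmod (\<phi> z)) ` sphere 0 r)" by (rule bdd_belowI2[of _ 0]) simp
  ultimately have sph: "m \<le> cmod (\<phi> z)" if "cmod z = r" for z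
    using cINF_lower[of "\<lambda>z. cmod (\<phi> z)" "sphere 0 r" z] that by simp
  have "cmod (1 / \<phi> w) \<le> 1 / m"
  proof (rule maximum_modulus_frontier[where S = "cball 0 r" and f = "\<lambda>z. 1 / \<phi> z"])
    have h: "(\<lambda>z. 1 / \<phi> z) holomorphic_on ball 0 1" by (intro holomorphic_intros \<phi>_holomorphic nz) auto
    show "(\<lambda>z. 1 / \<phi> z) holomorphic_on interior (cball 0 r)" by (rule holomorphic_on_subset[OF h]) (use r in auto)
    show "continuous_on (closure (cball 0 r)) (\<lambda>z. 1 / \<phi> z)"
      by (rule continuous_on_subset[OF holomorphic_on_imp_continuous_on[OF h]]) (use r in auto)
    fix z :: complex assume "z \<in> frontier (cball 0 r)"
    then show "cmod (1 / \<phi> z) \<le> 1 / m" using sph[of z] m by (simp add: norm_divide frac_le)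
  qed (use w in auto)
  moreover have "\<phi> w \<noteq> 0" by (rule nz) (use w r in simp)
  ultimately show ?thesis using m by (simp add: norm_divide field_simps m_def)
qed

text \<open>The logarithm of \<open>h z / z\<close>, where \<open>h\<close> solves \<open>z * deriv h z / h z = \<phi> z\<close>.\<close>
definition k :: "complex \<Rightarrow> complex" where
  "k = (SOME A. A holomorphic_on ball 0 1 \<and> A 0 = 0 \<and> (\<forall>z\<in>ball 0 1. z * deriv A z = \<phi> z - 1)
          \<and> deriv A 0 = deriv \<phi> 0)"

lemma k_holomorphic: "k holomorphic_on ball 0 1" and k_zero: "k 0 = 0"
  and dk: "z \<in> ball 0 1 \<Longrightarrow> z * deriv k z = \<phi> z - 1" and dk0: "deriv k 0 = deriv \<phi> 0"
proof -
  obtain A where "A holomorphic_on ball 0 1" "A 0 = 0" "\<And>z. z \<in> ball 0 1 \<Longrightarrow> z * deriv A z = \<phi> z - 1"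
    "deriv A 0 = deriv (\<lambda>z. \<phi> z - 1) 0"
    by (rule radial_primitive_exists[of "\<lambda>z. \<phi> z - 1"]) (auto intro!: holomorphic_intros \<phi>_holomorphic simp: \<phi>0)
  moreover have "deriv (\<lambda>z. \<phi> z - 1) 0 = deriv \<phi> 0"
    by (rule DERIV_imp_deriv) (auto intro!: derivative_eq_intros holomorphic_derivI[OF \<phi>_holomorphic open_ball])
  ultimately have "\<exists>A. A holomorphic_on ball 0 1 \<and> A 0 = 0 \<and> (\<forall>z\<in>ball 0 1. z * deriv A z = \<phi> z - 1)
          \<and> deriv A 0 = deriv \<phi> 0" by (intro exI[of _ A]) auto
  from someI_ex[OF this, folded k_def]
  show "k holomorphic_on ball 0 1" "k 0 = 0" "z \<in> ball 0 1 \<Longrightarrow> z * deriv k z = \<phi> z - 1" "deriv k 0 = deriv \<phi> 0"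
    by auto
qed

lemma ray_ordered_\<phi>: "ray_ordered (\<lambda>z. \<phi> z - 1)"
proof (rule univalent_starlike_ray_ordered)
  show "(\<lambda>z. \<phi> z - 1) holomorphic_on ball 0 1" by (intro holomorphic_intros \<phi>_holomorphic)
  show "inj_on (\<lambda>z. \<phi> z - 1) (ball 0 1)" using \<phi>_injective by (simp add: inj_on_def)
  fix z :: complex and t :: real assume z: "z \<in> ball 0 1" and t: "0 \<le> t" "t \<le> 1"
  have "(1 - t) *\<^sub>R \<phi> 0 + t *\<^sub>R \<phi> z \<in> closed_segment (\<phi> 0) (\<phi> z)" using t by (auto simp: closed_segment_def)
  also have "\<dots> \<subseteq> \<phi> ` ball 0 1" using mm z unfolding ma_minda_def by blast
  finally obtain y where "y \<in> ball 0 1" "(1 - t) *\<^sub>R \<phi> 0 + t *\<^sub>R \<phi> z = \<phi> y" by blast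
  then show "of_real t * (\<phi> z - 1) \<in> (\<lambda>z. \<phi> z - 1) ` ball 0 1"
    by (intro image_eqI[of _ _ y]) (auto simp: \<phi>0 scaleR_conv_of_real algebra_simps dest: sym)
qed (simp add: \<phi>0)

sublocale radial_primitive k
proof
  show "ray_ordered (\<lambda>z. z * deriv k z)"
    using ray_ordered_\<phi> unfolding ray_ordered_def by (simp add: dk)
  fix z :: complex assume z: "z \<in> ball 0 1"
  show "deriv k z \<noteq> 0"
  proof (cases "z = 0")
    case True then show ?thesis using dk0 d\<phi>0 by simp
  next
    case False
    then have "\<phi> z \<noteq> 1" using \<phi>_injective z \<phi>0 by (metis centre_in_ball inj_on_def zero_less_one)
    then show ?thesis using dk[OF z] by auto
  qed
qed (rule k_holomorphic k_zero)+

lemma reflect_k: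
  assumes z: "z \<in> ball 0 1"
  shows "cnj (k (cnj z)) = k z"
proof -
  have "cnj (k (cnj z)) - k z = cnj (k (cnj 0)) - k 0"
  proof (rule vanishing_radial_derivative[OF _ _ z, of "\<lambda>z. cnj (k (cnj z)) - k z"])
    show "(\<lambda>z. cnj (k (cnj z)) - k z) holomorphic_on ball 0 1"
      by (intro holomorphic_intros holomorphic_on_reflect k_holomorphic)
    fix x :: complex assume x: "x \<in> ball 0 1"
    have "deriv (\<lambda>z. cnj (k (cnj z)) - k z) x = cnj (deriv k (cnj x)) - deriv k x"
      using holomorphic_derivI[OF holomorphic_on_reflect(1)[OF k_holomorphic] open_ball x] holomorphic_derivI[OF k_holomorphic open_ball x]
      by (intro DERIV_imp_deriv derivative_eq_intros) (auto simp: holomorphic_on_reflect(2)[OF k_holomorphic x])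
    then have "x * deriv (\<lambda>z. cnj (k (cnj z)) - k z) x = cnj (cnj x * deriv k (cnj x)) - x * deriv k x"
      by (simp only: right_diff_distrib complex_cnj_mult complex_cnj_cnj)
    also have "\<dots> = 0" using dk[of "cnj x"] dk[OF x] x reflect\<phi>[OF x] by simp
    finally show "x * deriv (\<lambda>z. cnj (k (cnj z)) - k z) x = 0" .
  qed
  then show ?thesis using k_zero by simp
qed

lemma k_real: "\<bar>y\<bar> < 1 \<Longrightarrow> k (of_real y) = of_real (Re (k (of_real y)))"
  using reflect_k[of "of_real y"] by (simp add: complex_eq_iff)

lemma \<phi>_real: "\<bar>y\<bar> < 1 \<Longrightarrow> \<phi> (of_real y) = of_real (Re (\<phi> (of_real y)))"
  using reflect\<phi>[of "of_real y"] by (simp add: complex_eq_iff)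

lemma \<phi>_neg_less_one: assumes "0 < r" "r < 1" shows "Re (\<phi> (- of_real r)) < 1"
proof -
  have "Re (\<phi> (- of_real r)) \<le> 1" using modulus_lower_bound[OF assms, of 0] assms \<phi>0 by simp
  moreover have "\<phi> (- of_real r) \<noteq> 1"
    using \<phi>_injective \<phi>0 assms unfolding inj_on_def
    by (metis centre_in_ball mem_ball_0 neg_equal_0_iff_equal norm_minus_cancel norm_of_real abs_of_pos of_real_eq_0_iff less_irrefl zero_less_one)
  ultimately show ?thesis using real_neg[OF assms] by (metis less_le of_real_1)
qed

text \<open>If \<open>\<phi> r < 1\<close>, then \<open>\<phi> r - 1\<close> and \<open>\<phi> (- r) - 1\<close> are both negative, hence on one ray, although the points
  \<open>r\<close> and \<open>- r\<close> have equal modulus.\<close>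
lemma \<phi>_pos_greater_one: assumes "0 < r" "r < 1" shows "Re (\<phi> (of_real r)) > 1"
proof (rule ccontr)
  assume n: "\<not> ?thesis"
  define p where "p = Re (\<phi> (of_real r)) - 1"
  define q where "q = Re (\<phi> (- of_real r)) - 1"
  have pq: "\<phi> (of_real r) - 1 = of_real p" "\<phi> (- of_real r) - 1 = of_real q"
    using \<phi>_real[of r] real_neg[OF assms] assms by (simp_all add: p_def q_def)
  have b: "complex_of_real r \<in> ball 0 1" "- complex_of_real r \<in> ball 0 1" using assms by auto
  have ne: "complex_of_real r \<noteq> - complex_of_real r" "- complex_of_real r \<noteq> complex_of_real r" using assms by (auto simp: complex_eq_iff)
  have q: "q < 0" using \<phi>_neg_less_one[OF assms] by (simp add: q_def)
  have "p \<noteq> 0"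
    using inj_onD[OF \<phi>_injective, of "of_real r" 0] pq(1) assms \<phi>0 by auto
  then have p: "p < 0" using n by (simp add: p_def)
  consider "p / q \<le> 1" | "q / p \<le> 1" using p q linear[of p q] by (auto simp: divide_le_eq)
  then show False
  proof cases
    case 1
    have "\<phi> (of_real r) - 1 = of_real (p / q) * (\<phi> (- of_real r) - 1)" using pq q by simp
    moreover have "0 < p / q" using p q by (simp add: divide_neg_neg)
    ultimately show False using ray_ordered_\<phi> b ne 1 unfolding ray_ordered_def by fastforce
  next
    case 2
    have "\<phi> (- of_real r) - 1 = of_real (q / p) * (\<phi> (of_real r) - 1)" using pq p by simp
    moreover have "0 < q / p" using p q by (simp add: divide_neg_neg)
    ultimately show False using ray_ordered_\<phi> b ne 2 unfolding ray_ordered_def by fastforce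
  qed
qed

lemma k_real_derivative:
  assumes "\<bar>y\<bar> < 1"
  shows "((\<lambda>y. Re (k (of_real y))) has_real_derivative Re (deriv k (of_real y))) (at y)"
    and "y \<noteq> 0 \<Longrightarrow> Re (deriv k (of_real y)) > 0"
    and "y * Re (deriv k (of_real y)) = Re (\<phi> (of_real y)) - 1"
proof -
  have b: "complex_of_real y \<in> ball 0 1" using assms by simp
  have "(k has_field_derivative deriv k (of_real y)) (at (of_real y))" by (rule holomorphic_derivI[OF k_holomorphic open_ball b])
  from has_vector_derivative_real_field[OF this, of UNIV]
  show "((\<lambda>y. Re (k (of_real y))) has_real_derivative Re (deriv k (of_real y))) (at y)"
    unfolding has_real_derivative_iff_has_vector_derivative
    by (rule bounded_linear.has_vector_derivative[OF bounded_linear_Re])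
  have "Re (of_real y * deriv k (of_real y)) = Re (\<phi> (of_real y) - 1)" using dk[OF b] by simp
  then show eq: "y * Re (deriv k (of_real y)) = Re (\<phi> (of_real y)) - 1" by simp
  assume "y \<noteq> 0"
  then consider "y > 0" | "y < 0" by linarith
  then show "Re (deriv k (of_real y)) > 0"
  proof cases
    case 1
    then have "0 < y * Re (deriv k (of_real y))" using \<phi>_pos_greater_one[of y] eq assms by simp
    then show ?thesis using 1 by (rule zero_less_mult_pos)
  next
    case 2
    then have "y * Re (deriv k (of_real y)) < 0" using \<phi>_neg_less_one[of "-y"] eq assms by simp
    then show ?thesis using 2 by (simp add: mult_less_0_iff)
  qed
qed

lemma k_mono:
  assumes "-1 < a" "a \<le> b" "b < 1"
  shows "Re (k (of_real a)) \<le> Re (k (of_real b))"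
proof (rule DERIV_nonneg_imp_nondecreasing[OF assms(2)])
  fix x assume x: "a \<le> x" "x \<le> b"
  have "Re (deriv k (of_real x)) \<ge> 0"
  proof (cases "x = 0")
    case True
    have "Re (deriv \<phi> 0) > 0" using mm by (simp add: ma_minda_def)
    then show ?thesis using True dk0 by simp
  next
    case False
    moreover have "\<bar>x\<bar> < 1" using x assms by linarith
    ultimately show ?thesis using k_real_derivative(2)[of x] by simp
  qed
  then show "\<exists>y. ((\<lambda>y. Re (k (of_real y))) has_real_derivative y) (at x) \<and> 0 \<le> y"
    using k_real_derivative(1)[of x] x assms by (intro exI[of _ "Re (deriv k (of_real x))"]) auto
qed

text \<open>The set \<open>k ` cball 0 r\<close> is convex and invariant under conjugation, so with \<open>w\<close> it contains the real number
  \<open>Re w\<close>. Real values are taken only at real points, where \<open>k\<close> is increasing.\<close>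
lemma Re_image_cball_ge:
  assumes w: "w \<in> k ` cball 0 r" and r: "r < 1"
  shows "Re (k (- of_real r)) \<le> Re w"
proof -
  obtain \<zeta> where \<zeta>: "cmod \<zeta> \<le> r" "w = k \<zeta>" using w by auto
  have \<zeta>1: "\<zeta> \<in> ball 0 1" using \<zeta> r by simp
  have "convex (k ` cball 0 r)" by (rule convex_image_cball[OF _ injective r]) simp
  then have "(1/2) *\<^sub>R k \<zeta> + (1/2) *\<^sub>R k (cnj \<zeta>) \<in> k ` cball 0 r"
    using \<zeta> by (intro convexD) auto
  moreover have "k (cnj \<zeta>) = cnj (k \<zeta>)" using reflect_k[OF \<zeta>1] by (metis complex_cnj_cnj)
  then have "(1/2) *\<^sub>R k \<zeta> + (1/2) *\<^sub>R k (cnj \<zeta>) = of_real (Re w)" by (simp add: \<zeta> complex_eq_iff)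
  ultimately obtain x where x: "cmod x \<le> r" "k x = of_real (Re w)" by auto
  have x1: "x \<in> ball 0 1" "cnj x \<in> ball 0 1" using x r by auto
  have "k (cnj x) = k x" using reflect_k[OF x1(1)] x(2) by (metis complex_cnj_cnj complex_cnj_complex_of_real)
  then have "cnj x = x" using injective x1 by (auto simp: inj_on_def)
  then have xr: "x = of_real (Re x)" by (simp add: complex_eq_iff)
  have a: "\<bar>Re x\<bar> \<le> r" using x(1) abs_Re_le_cmod[of x] by linarith
  then have "Re (k (of_real (- r))) \<le> Re (k (of_real (Re x)))" using r by (intro k_mono) auto
  also have "\<dots> = Re w" using x(2) xr by simp
  finally show ?thesis by simp
qed


section \<open>Growth and factorization\<close>

text \<open>The function \<open>t \<mapsto> - h (- t)\<close> for \<open>h z = z * exp (k z)\<close>.\<close>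
definition H :: "real \<Rightarrow> real" where
  "H t = t * exp (Re (k (- of_real t)))"

definition L :: real where
  "L = (SUP t\<in>{0..<1}. H t)"

lemma H_has_derivative:
  assumes "\<bar>t\<bar> < 1"
  shows "(H has_real_derivative exp (Re (k (- of_real t))) * Re (\<phi> (- of_real t))) (at t)"
proof -
  have "((\<lambda>y. Re (k (of_real y))) has_real_derivative Re (deriv k (of_real (- t)))) (at (- t))"
    by (rule k_real_derivative(1)) (use assms in simp)
  moreover have "((\<lambda>t::real. - t) has_real_derivative -1) (at t)" by (auto intro!: derivative_eq_intros)
  ultimately have kd: "((\<lambda>t. Re (k (- of_real t))) has_real_derivative - Re (deriv k (- of_real t))) (at t)"
    using DERIV_chain2[of "\<lambda>y. Re (k (of_real y))" _ "\<lambda>t. - t" t "-1" UNIV] by simp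
  have e: "- t * Re (deriv k (- of_real t)) = Re (\<phi> (- of_real t)) - 1"
    using k_real_derivative(3)[of "- t"] assms by simp
  have "(H has_real_derivative exp (Re (k (- of_real t))) + t * (exp (Re (k (- of_real t))) * - Re (deriv k (- of_real t)))) (at t)"
    unfolding H_def
    by (rule DERIV_cong[OF DERIV_mult[OF DERIV_ident DERIV_fun_exp[OF kd]]]) (simp add: algebra_simps)
  also have "exp (Re (k (- of_real t))) + t * (exp (Re (k (- of_real t))) * - Re (deriv k (- of_real t)))
      = exp (Re (k (- of_real t))) * (1 + - t * Re (deriv k (- of_real t)))" by (simp add: algebra_simps)
  finally show ?thesis unfolding e by simp
qed

lemma H_less:
  assumes "0 \<le> a" "a < b" "b < 1"
  shows "H a < H b"
proof (rule DERIV_pos_imp_increasing[OF assms(2)])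
  fix x assume x: "a \<le> x" "x \<le> b"
  have "0 < Re (\<phi> (- of_real x))" by (intro Re\<phi>) (use x assms in simp)
  then show "\<exists>y. (H has_real_derivative y) (at x) \<and> 0 < y"
    using H_has_derivative[of x] x assms by (intro exI[of _ "exp (Re (k (- of_real x))) * Re (\<phi> (- of_real x))"]) auto
qed

lemma H_le: "0 \<le> t \<Longrightarrow> t < 1 \<Longrightarrow> H t \<le> t"
  using k_mono[of "- t" 0] k_zero by (simp add: H_def mult_left_le)

lemma bdd_H: "bdd_above (H ` {0..<1})"
  by (rule bdd_aboveI2[of _ _ 1]) (use H_le in force)

lemma H_less_L: "0 \<le> t \<Longrightarrow> t < 1 \<Longrightarrow> H t < L"
proof -
  assume t: "0 \<le> t" "t < 1"
  have "H t < H ((1 + t) / 2)" by (rule H_less) (use t in auto)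
  also have "\<dots> \<le> L" unfolding L_def by (rule cSUP_upper[OF _ bdd_H]) (use t in auto)
  finally show ?thesis .
qed

lemma L_le_1: "L \<le> 1"
  unfolding L_def by (rule cSUP_least) (use H_le in force)+

lemma L_pos: "0 < L"
  using H_less_L[of 0] by (simp add: H_def)

lemma H_tendsto: "(H \<longlongrightarrow> L) (at_left 1)"
proof (rule order_tendstoI)
  fix c assume "c < L"
  then obtain s where s: "s \<in> {0..<1}" "c < H s" unfolding L_def using less_cSUP_iff[OF _ bdd_H] by auto
  have "\<forall>\<^sub>F t in at_left (1::real). t \<in> {s<..<1}" by (rule eventually_at_left_real) (use s in simp)
  then show "\<forall>\<^sub>F t in at_left 1. c < H t" 
  proof eventually_elim
    case (elim t) then show ?case using s H_less[of s t] by simp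
  qed
next
  fix c assume "c > L"
  have "\<forall>\<^sub>F t in at_left (1::real). t \<in> {0<..<1}" by (rule eventually_at_left_real) simp
  then show "\<forall>\<^sub>F t in at_left 1. H t < c" 
  proof eventually_elim
    case (elim t) then show ?case using \<open>c > L\<close> H_less_L[of t] by simp
  qed
qed

lemma value_at_minus_one_eq:
  assumes "\<And>z. z \<in> ball 0 1 \<Longrightarrow> h z = z * exp (k z)"
  shows "value_at_minus_one h = - of_real L"
  unfolding value_at_minus_one_def
proof (rule tendsto_Lim)
  have "((\<lambda>t. - complex_of_real (H t)) \<longlongrightarrow> - of_real L) (at_left 1)"
    by (intro tendsto_intros H_tendsto)
  moreover have "\<forall>\<^sub>F t in at_left (1::real). t \<in> {0<..<1}" by (rule eventually_at_left_real) simp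
  then have "\<forall>\<^sub>F t in at_left (1::real). - complex_of_real (H t) = h (- of_real t)"
  proof eventually_elim
    case (elim t)
    then have "k (- of_real t) = of_real (Re (k (- of_real t)))" using k_real[of "- t"] by simp
    moreover have "h (- of_real t) = - of_real t * exp (k (- of_real t))" by (rule assms) (use elim in simp)
    ultimately show ?case by (simp add: H_def) (metis exp_of_real)
  qed
  ultimately show "((\<lambda>t. h (- complex_of_real t)) \<longlongrightarrow> - of_real L) (at_left 1)"
    by (rule Lim_transform_eventually)
qed simp

text \<open>Here \<open>g\<close> is the symmetrization of \<open>f\<close> under reflection. Its logarithmic derivative is the mean of \<open>\<phi> \<circ> \<omega>\<close> and
  \<open>\<phi> \<circ> \<omega>'\<close> with the reflected Schwarz function \<open>\<omega>'\<close>, so \<open>log (g z / z)\<close> is the mean \<open>B\<close> of the two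
  corresponding primitives and \<open>B = k \<circ> w\<close> by convexity.\<close>
lemma starlike_conj_factorization:
  assumes f: "f \<in> starlike_conj \<phi>"
  obtains g \<omega> w where
    "\<omega> holomorphic_on ball 0 1" "\<omega> 0 = 0" "\<omega> ` ball 0 1 \<subseteq> ball 0 1"
    "\<And>z. z \<in> ball 0 1 \<Longrightarrow> z * deriv f z = g z * \<phi> (\<omega> z)"
    "g holomorphic_on ball 0 1" "g 0 = 0" "deriv g 0 = 1"
    "\<And>z. z \<in> ball 0 1 - {0} \<Longrightarrow> Re (z * deriv g z / g z) > 0"
    "w holomorphic_on ball 0 1" "w 0 = 0" "\<And>z. z \<in> ball 0 1 \<Longrightarrow> cmod (w z) \<le> cmod z"
    "\<And>z. z \<in> ball 0 1 \<Longrightarrow> g z = z * exp (k (w z))"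
proof -
  have holf: "f holomorphic_on ball 0 1" using f by (simp add: starlike_conj_def class_A_def)
  obtain a where a: "normalized_expansion f a" using f by (auto simp: starlike_conj_def class_A_def)
  have f0: "f 0 = 0" "deriv f 0 = 1" using normalized_expansion_taylor[OF a] by auto
  have fnz: "f z + cnj (f (cnj z)) \<noteq> 0" if "z \<in> ball 0 1 - {0}" for z using f that by (auto simp: starlike_conj_def)
  obtain \<omega> where \<omega>: "\<omega> holomorphic_on ball 0 1" "\<omega> ` ball 0 1 \<subseteq> ball 0 1" "\<omega> 0 = 0"
    "\<And>z. z \<in> ball 0 1 \<Longrightarrow> conj_quotient f z = \<phi> (\<omega> z)"
    using f unfolding starlike_conj_def subordinate_def by blast
  define g where "g z = (f z + cnj (f (cnj z))) / 2" for z
  have holg: "g holomorphic_on ball 0 1"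
    unfolding g_def by (intro holomorphic_intros holomorphic_on_reflect holf) auto
  have g0: "g 0 = 0" by (simp add: g_def f0)
  have gnz: "g z \<noteq> 0" if "z \<in> ball 0 1 - {0}" for z using fnz[OF that] by (simp add: g_def)
  have gref: "cnj (g (cnj z)) = g z" for z by (simp add: g_def add.commute)
  have dg: "deriv g z = (deriv f z + cnj (deriv f (cnj z))) / 2" if "z \<in> ball 0 1" for z
  proof -
    have "((\<lambda>z. cnj (f (cnj z))) has_field_derivative cnj (deriv f (cnj z))) (at z)"
      using holomorphic_derivI[OF holomorphic_on_reflect(1)[OF holf] open_ball that] holomorphic_on_reflect(2)[OF holf that] by simp
    then show ?thesis
      unfolding g_def
      by (intro DERIV_imp_deriv) (auto intro!: derivative_eq_intros holomorphic_derivI[OF holf open_ball that])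
  qed
  have fg: "z * deriv f z = g z * \<phi> (\<omega> z)" if z: "z \<in> ball 0 1" for z
  proof (cases "z = 0")
    case False
    then have "\<phi> (\<omega> z) = z * deriv f z / g z"
      using \<omega>(4)[OF z] by (simp add: conj_quotient_def g_def mult_ac)
    then show ?thesis using gnz[of z] z False by simp
  qed (simp add: g0)
  define \<omega>' where "\<omega>' z = cnj (\<omega> (cnj z))" for z
  have \<omega>b: "\<omega> z \<in> ball 0 1" if "z \<in> ball 0 1" for z using \<omega>(2) that by blast
  have hol\<omega>': "\<omega>' holomorphic_on ball 0 1" unfolding \<omega>'_def by (rule holomorphic_on_reflect[OF \<omega>(1)])
  have \<omega>'b: "\<omega>' z \<in> ball 0 1" if "z \<in> ball 0 1" for z using \<omega>b[of "cnj z"] that by (simp add: \<omega>'_def)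
  have zdg: "z * deriv g z = g z * ((\<phi> (\<omega> z) + \<phi> (\<omega>' z)) / 2)" if z: "z \<in> ball 0 1" for z
  proof -
    have cz: "cnj z \<in> ball 0 1" using z by simp
    have "z * deriv g z = (z * deriv f z + cnj (cnj z * deriv f (cnj z))) / 2"
      by (simp add: dg[OF z] algebra_simps)
    also have "cnj (cnj z * deriv f (cnj z)) = cnj (g (cnj z)) * cnj (\<phi> (\<omega> (cnj z)))" unfolding fg[OF cz] by simp
    also have "\<dots> = g z * \<phi> (\<omega>' z)"
      using reflect\<phi>[OF \<omega>'b[OF z]] by (simp add: gref \<omega>'_def)
    finally show ?thesis by (simp add: fg[OF z] algebra_simps)
  qed
  have quot: "z * deriv g z / g z = (\<phi> (\<omega> z) + \<phi> (\<omega>' z)) / 2" if "z \<in> ball 0 1 - {0}" for z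
    using zdg[of z] gnz[OF that] that by (simp add: field_simps)
  have Q: "(\<lambda>z. \<phi> (u z) - 1) holomorphic_on ball 0 1" if "u holomorphic_on ball 0 1" "\<And>z. z \<in> ball 0 1 \<Longrightarrow> u z \<in> ball 0 1" for u
    by (intro holomorphic_intros holomorphic_on_compose_gen[OF that(1) \<phi>_holomorphic, unfolded o_def]) (use that(2) in blast)
  have \<omega>'0: "\<omega>' 0 = 0" by (simp add: \<omega>'_def \<omega>(3))
  obtain A1 where A1: "A1 holomorphic_on ball 0 1" "A1 0 = 0" "\<And>z. z \<in> ball 0 1 \<Longrightarrow> z * deriv A1 z = \<phi> (\<omega> z) - 1"
    by (rule radial_primitive_exists[OF Q[OF \<omega>(1) \<omega>b]]) (auto simp: \<omega>(3) \<phi>0)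
  obtain A2 where A2: "A2 holomorphic_on ball 0 1" "A2 0 = 0" "\<And>z. z \<in> ball 0 1 \<Longrightarrow> z * deriv A2 z = \<phi> (\<omega>' z) - 1"
    by (rule radial_primitive_exists[OF Q[OF hol\<omega>' \<omega>'b]]) (auto simp: \<omega>'0 \<phi>0)
  define B where "B z = of_real (1/2) * A1 z + of_real (1 - 1/2) * A2 z" for z
  have holB: "B holomorphic_on ball 0 1" unfolding B_def by (intro holomorphic_intros A1 A2)
  have dB: "z * deriv B z = (\<phi> (\<omega> z) + \<phi> (\<omega>' z)) / 2 - 1" if z: "z \<in> ball 0 1" for z
  proof -
    have "deriv B z = of_real (1/2) * deriv A1 z + of_real (1 - 1/2) * deriv A2 z"
      unfolding B_def
      by (rule DERIV_imp_deriv)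
         (intro DERIV_add DERIV_cmult holomorphic_derivI[OF A1(1) open_ball z] holomorphic_derivI[OF A2(1) open_ball z])
    then have "z * deriv B z = (z * deriv A1 z) / 2 + (z * deriv A2 z) / 2" by (simp add: algebra_simps)
    moreover have "(p - 1) / 2 + (q - 1) / 2 = (p + q) / 2 - 1" for p q :: complex by (simp add: field_simps)
    ultimately show ?thesis unfolding A1(3)[OF z] A2(3)[OF z] by simp
  qed
  have schwarz: "cmod (u z) \<le> cmod z" if "u holomorphic_on ball 0 1" "u 0 = 0" "\<And>z. z \<in> ball 0 1 \<Longrightarrow> u z \<in> ball 0 1" "z \<in> ball 0 1" for u z
    by (rule Schwarz_Lemma(1)[OF that(1,2)]) (use that in auto)
  have Bim: "B z \<in> k ` cball 0 (cmod z)" if z: "z \<in> ball 0 1" for z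
    unfolding B_def
  proof (rule convex_combination_in_image[OF order_refl injective A1(1) A2(1) A1(2) A2(2)])
    show "x * deriv A1 x = \<omega> x * deriv k (\<omega> x)" if "x \<in> ball 0 1" for x using A1(3)[OF that] dk[OF \<omega>b[OF that]] by simp
    show "x * deriv A2 x = \<omega>' x * deriv k (\<omega>' x)" if "x \<in> ball 0 1" for x using A2(3)[OF that] dk[OF \<omega>'b[OF that]] by simp
    show "cmod (\<omega> x) \<le> cmod x" if "x \<in> ball 0 1" for x by (rule schwarz[OF \<omega>(1,3) \<omega>b that])
    show "cmod (\<omega>' x) \<le> cmod x" if "x \<in> ball 0 1" for x by (rule schwarz[OF hol\<omega>' \<omega>'0 \<omega>'b that])
  qed (use z in auto)
  obtain K where K: "K holomorphic_on k ` ball 0 1"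
     "\<And>z. z \<in> ball 0 1 \<Longrightarrow> deriv k z * deriv K (k z) = 1" "\<And>z. z \<in> ball 0 1 \<Longrightarrow> K (k z) = z"
    using holomorphic_has_inverse[OF k_holomorphic open_ball injective] by blast
  define w where "w z = K (B z)" for z
  have kw: "k (w z) = B z" "cmod (w z) \<le> cmod z" if z: "z \<in> ball 0 1" for z
  proof -
    obtain x where x: "cmod x \<le> cmod z" "B z = k x" using Bim[OF z] by auto
    then have "K (k x) = x" using z by (intro K(3)) simp
    then show "k (w z) = B z" "cmod (w z) \<le> cmod z" using x by (simp_all add: w_def)
  qed
  have dg0: "deriv g 0 = 1" using dg[of 0] f0 by simp
  show ?thesis
  proof (rule that[of \<omega> g w])
    show "w holomorphic_on ball 0 1"
      unfolding w_def
    proof (rule holomorphic_on_compose_gen[OF holB K(1), unfolded o_def])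
      show "B ` ball 0 1 \<subseteq> k ` ball 0 1"
      proof (rule image_subsetI)
        fix x :: complex assume x: "x \<in> ball 0 1"
        have "k ` cball 0 (cmod x) \<subseteq> k ` ball 0 1" using x by (intro image_mono) auto
        then show "B x \<in> k ` ball 0 1" using Bim[OF x] by blast
      qed
    qed
    show "w 0 = 0" using kw(2)[of 0] by simp
    fix z :: complex
    show "Re (z * deriv g z / g z) > 0" if "z \<in> ball 0 1 - {0}"
      unfolding quot[OF that] using Re\<phi>[OF \<omega>b] Re\<phi>[OF \<omega>'b] that by (simp add: add_pos_pos)
    show "g z = z * exp (k (w z))" if z: "z \<in> ball 0 1"
      unfolding kw(1)[OF z]
    proof (rule eq_times_exp_radial_primitive[OF holg g0 dg0 _ holB _ z])
      show "B 0 = 0" by (simp add: B_def A1 A2)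
      show "g x \<noteq> 0 \<and> x * deriv g x / g x = 1 + x * deriv B x" if "x \<in> ball 0 1 - {0}" for x
        using quot[OF that] gnz[OF that] dB[of x] that by simp
    qed
  qed (use \<omega> fg holg g0 dg0 kw in auto)
qed

section \<open>The distance to the boundary\<close>

text \<open>Univalence comes from the comparison function \<open>G\<close> with \<open>z * deriv G z = g z\<close>, which is convex because \<open>g\<close> is
  starlike, and for which \<open>deriv f z / deriv G z = \<phi> (\<omega> z)\<close>. The covered disc comes from
  \<open>deriv f z = exp (k (w z)) * \<phi> (\<omega> z)\<close>, both factors being smallest at \<open>- \<bar>z\<bar>\<close>.\<close>
lemma starlike_conj_distance:
  assumes f: "f \<in> starlike_conj \<phi>"
  shows "L \<le> infdist (f 0) (frontier (f ` ball 0 1))"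
proof -
  have holf: "f holomorphic_on ball 0 1" using f by (simp add: starlike_conj_def class_A_def)
  obtain a where a: "normalized_expansion f a" using f by (auto simp: starlike_conj_def class_A_def)
  have f0: "f 0 = 0" "deriv f 0 = 1" using normalized_expansion_taylor[OF a] by auto
  obtain g \<omega> w where \<omega>: "\<omega> holomorphic_on ball 0 1" "\<omega> 0 = 0" "\<omega> ` ball 0 1 \<subseteq> ball 0 1"
    and fg: "\<And>z. z \<in> ball 0 1 \<Longrightarrow> z * deriv f z = g z * \<phi> (\<omega> z)"
    and g: "g holomorphic_on ball 0 1" "g 0 = 0" "deriv g 0 = 1"
      "\<And>z. z \<in> ball 0 1 - {0} \<Longrightarrow> Re (z * deriv g z / g z) > 0"
    and w: "w holomorphic_on ball 0 1" "w 0 = 0" "\<And>z. z \<in> ball 0 1 \<Longrightarrow> cmod (w z) \<le> cmod z"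
    and gw: "\<And>z. z \<in> ball 0 1 \<Longrightarrow> g z = z * exp (k (w z))"
    by (rule starlike_conj_factorization[OF f]) (rule that; assumption)
  have \<omega>b: "\<omega> z \<in> ball 0 1" if "z \<in> ball 0 1" for z using \<omega>(3) that by blast
  have gnz: "g z \<noteq> 0" if "z \<in> ball 0 1 - {0}" for z using gw[of z] that by simp
  obtain G where G: "G holomorphic_on ball 0 1" "G 0 = 0" "\<And>z. z \<in> ball 0 1 \<Longrightarrow> z * deriv G z = g z"
    "deriv G 0 = deriv g 0"
    by (rule radial_primitive_exists[OF g(1,2)]) (rule that; assumption)
  interpret G: radial_primitive G
  proof
    show "deriv G z \<noteq> 0" if "z \<in> ball 0 1" for z
      using G(3)[OF that] G(4) g(3) gnz[of z] that by (cases "z = 0") auto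
    have "ray_ordered g" by (rule starlike_injective_ray_ordered(2)[OF g(1,2) _ g(4)]) (simp add: g(3))
    then show "ray_ordered (\<lambda>z. z * deriv G z)" by (simp add: ray_ordered_def G(3))
  qed (use G in auto)
  have df: "deriv f z = exp (k (w z)) * \<phi> (\<omega> z)" if "z \<in> ball 0 1 - {0}" for z
    using fg[of z] gw[of z] that by simp
  have "inj_on f (ball 0 1)"
  proof (rule injective_if_derivative_quotient_Re_pos[OF holf G(1) G.injective])
    show "convex (G ` ball 0 1)" by (rule G.convex_image_ball[OF order_refl G.injective])
    fix z :: complex assume z: "z \<in> ball 0 1"
    show "Re (deriv f z / deriv G z) > 0"
    proof (cases "z = 0")
      case True then show ?thesis using f0 G(4) g(3) by simp
    next
      case False
      have "deriv f z / deriv G z = (z * deriv f z) / (z * deriv G z)" using False by simp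
      also have "\<dots> = \<phi> (\<omega> z)" unfolding fg[OF z] G(3)[OF z] using gnz[of z] z False by simp
      finally show ?thesis using Re\<phi>[OF \<omega>b[OF z]] by simp
    qed
  qed
  note injf = this
  have cover: "ball 0 L \<subseteq> f ` ball 0 1"
  proof
    fix p :: complex assume "p \<in> ball 0 L"
    then have "cmod p < L" by simp
    then obtain s where s: "s \<in> {0..<1}" "cmod p < H s" unfolding L_def using less_cSUP_iff[OF _ bdd_H] by auto
    have "s \<noteq> 0" using s(2) by (auto simp: H_def)
    show "p \<in> f ` ball 0 1"
    proof (rule ball_subset_image[where H = H and s = s and H' = "\<lambda>t. exp (Re (k (- of_real t))) * Re (\<phi> (- of_real t))"])
      have "isCont H t" if "t \<in> {0..<1}" for t
        using H_has_derivative[of t] that by (intro DERIV_isCont) auto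
      then show "continuous_on {0..<1} H" by (simp add: continuous_at_imp_continuous_on)
      fix z :: complex assume z: "z \<in> ball 0 1 - {0}"
      then have z1: "z \<in> ball 0 1" by simp
      have "k (w z) \<in> k ` cball 0 (cmod z)" using w(3)[OF z1] by simp
      then have "Re (k (- of_real (cmod z))) \<le> Re (k (w z))" using z1 by (intro Re_image_cball_ge) auto
      moreover have "cmod (\<omega> z) \<le> cmod z"
        by (rule Schwarz_Lemma(1)[OF \<omega>(1,2)]) (use \<omega>b z in auto)
      then have "Re (\<phi> (- of_real (cmod z))) \<le> cmod (\<phi> (\<omega> z))" using z by (intro modulus_lower_bound) auto
      moreover have "Re (\<phi> (- of_real (cmod z))) > 0" by (rule Re\<phi>) (use z in simp)
      ultimately show "exp (Re (k (- of_real (cmod z)))) * Re (\<phi> (- of_real (cmod z))) \<le> cmod (deriv f z)"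
        unfolding df[OF z] norm_mult norm_exp_eq_Re by (intro mult_mono) auto
    next
      fix t :: real assume t: "0 < t" "t < 1"
      then show "(H has_real_derivative exp (Re (k (- of_real t))) * Re (\<phi> (- of_real t))) (at t)"
        by (intro H_has_derivative) simp
      show "0 < exp (Re (k (- of_real t))) * Re (\<phi> (- of_real t))"
        using t by (intro mult_pos_pos Re\<phi>) auto
    qed (use holf f0 s \<open>s \<noteq> 0\<close> in \<open>auto simp: H_def\<close>)
  qed
  show ?thesis
    unfolding f0(1)
  proof (rule infdist_frontier_ge[OF _ _ _ cover])
    show "open (f ` ball 0 1)" by (rule open_mapping_thm3[OF holf open_ball injf])
    show "f ` ball 0 1 \<noteq> UNIV" by (rule injective_image_not_UNIV[OF holf injf])
  qed auto
qed

section \<open>The majorant of f and the radius\<close>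

text \<open>The function \<open>h z / z\<close>.\<close>
definition u :: "complex \<Rightarrow> complex" where "u z = exp (k z)"

lemma holu: "u holomorphic_on ball 0 1"
  unfolding u_def by (intro holomorphic_intros k_holomorphic)

text \<open>The integrand of \<open>P\<close>, extended continuously to \<open>t = 0\<close>.\<close>
definition majorant_product :: "real \<Rightarrow> real" where
  "majorant_product t = majorant u t * majorant \<phi> t"

lemma continuous_majorant_product: "continuous_on {0..<1} majorant_product"
proof -
  have "isCont (majorant F) t" if "F holomorphic_on ball 0 1" "t \<in> {0..<1}" for F t
    using majorant_has_derivative[OF that(1), of t] that(2) by (intro DERIV_isCont) auto
  then show ?thesis
    unfolding majorant_product_def using holu \<phi>_holomorphic
    by (intro continuous_intros) (simp_all add: continuous_at_imp_continuous_on)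
qed

lemma majorant_product_ge:
  assumes t: "0 \<le> t" "t < 1"
  shows "1 + cmod (deriv \<phi> 0) * t \<le> majorant_product t"
proof -
  have "(\<Sum>n<1. cmod (fps_nth (fps_expansion u 0) n) * t ^ n) \<le> majorant u t"
    unfolding majorant_def by (rule sum_le_suminf[OF summable_majorant[OF holu t]]) (use t in auto)
  then have U: "1 \<le> majorant u t" by (simp add: fps_expansion_def u_def k_zero)
  have "(\<Sum>n<2. cmod (fps_nth (fps_expansion \<phi> 0) n) * t ^ n) \<le> majorant \<phi> t"
    unfolding majorant_def by (rule sum_le_suminf[OF summable_majorant[OF \<phi>_holomorphic t]]) (use t in auto)
  then have V: "1 + cmod (deriv \<phi> 0) * t \<le> majorant \<phi> t" by (simp add: fps_expansion_def \<phi>0 numeral_2_eq_2)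
  have "1 * (1 + cmod (deriv \<phi> 0) * t) \<le> majorant u t * majorant \<phi> t"
    by (rule mult_mono) (use U V t in auto)
  then show ?thesis by (simp add: majorant_product_def)
qed

lemma majorant_integral_eq:
  assumes h: "\<And>z. z \<in> ball 0 1 \<Longrightarrow> h z = z * exp (k z)" and r: "r < 1"
  shows "majorant_integral h \<phi> r = integral {0..r} majorant_product"
  unfolding majorant_integral_def
proof (rule integral_spike[of "{0}"])
  fix t assume t: "t \<in> {0..r} - {0}"
  have "majorant h t = majorant (\<lambda>z. z ^ 1 * u z) t" by (rule majorant_cong) (simp add: h u_def)
  also have "\<dots> = t * majorant u t" using majorant_times_z[OF holu, of t 1] t r by simp
  finally show "majorant_product t = majorant h t * majorant \<phi> t / t" using t by (simp add: majorant_product_def)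
qed simp

lemma integral_majorant_product_derivative:
  assumes "0 < r" "r < 1"
  shows "((\<lambda>r. integral {0..r} majorant_product) has_real_derivative majorant_product r) (at r)"
proof -
  obtain b where b: "r < b" "b < 1" using dense assms(2) by blast
  have "continuous_on {0..b} majorant_product" by (rule continuous_on_subset[OF continuous_majorant_product]) (use b in auto)
  then have "((\<lambda>r. integral {0..r} majorant_product) has_real_derivative majorant_product r) (at r within {0..b})"
    by (rule integral_has_real_derivative) (use assms b in auto)
  then show ?thesis using assms b by (simp add: at_within_Icc_at)
qed

lemma continuous_integral_majorant_product:
  assumes "b < 1"
  shows "continuous_on {0..b} (\<lambda>r. integral {0..r} majorant_product)"
  by (intro indefinite_integral_continuous_1 integrable_continuous_real continuous_on_subset[OF continuous_majorant_product])
     (use assms in auto)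

lemma integral_majorant_product_less:
  assumes "0 \<le> a" "a < b" "b < 1"
  shows "integral {0..a} majorant_product < integral {0..b} majorant_product"
proof (rule DERIV_pos_imp_increasing_open[OF assms(2), where f = "\<lambda>r. integral {0..r} majorant_product"])
  show "continuous_on {a..b} (\<lambda>r. integral {0..r} majorant_product)"
    by (rule continuous_on_subset[OF continuous_integral_majorant_product[OF assms(3)]]) (use assms in auto)
  fix x assume x: "a < x" "x < b"
  then have "0 < majorant_product x" using majorant_product_ge[of x] assms
    by (smt (verit) mult_nonneg_nonneg norm_ge_zero)
  then show "\<exists>y. ((\<lambda>r. integral {0..r} majorant_product) has_real_derivative y) (at x) \<and> 0 < y"
    using integral_majorant_product_derivative[of x] x assms by auto
qed

lemma integral_majorant_product_lower:
  assumes "0 \<le> r" "r < 1"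
  shows "r + cmod (deriv \<phi> 0) / 2 * r\<^sup>2 \<le> integral {0..r} majorant_product"
proof -
  have "integral {0..0} majorant_product - (0 + cmod (deriv \<phi> 0) / 2 * 0\<^sup>2)
      \<le> integral {0..r} majorant_product - (r + cmod (deriv \<phi> 0) / 2 * r\<^sup>2)"
  proof (rule DERIV_nonneg_imp_increasing_open[OF assms(1), where f = "\<lambda>r. integral {0..r} majorant_product - (r + cmod (deriv \<phi> 0) / 2 * r\<^sup>2)"])
    show "continuous_on {0..r} (\<lambda>r. integral {0..r} majorant_product - (r + cmod (deriv \<phi> 0) / 2 * r\<^sup>2))"
      by (intro continuous_intros continuous_integral_majorant_product assms)
    fix x assume x: "0 < x" "x < r"
    have "((\<lambda>r. integral {0..r} majorant_product - (r + cmod (deriv \<phi> 0) / 2 * r\<^sup>2)) has_real_derivative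
            majorant_product x - (1 + cmod (deriv \<phi> 0) / 2 * (2 * x))) (at x)"
      by (intro DERIV_diff DERIV_add DERIV_ident DERIV_cmult integral_majorant_product_derivative)
         (use x assms in \<open>auto intro!: derivative_eq_intros\<close>)
    then show "\<exists>y. ((\<lambda>r. integral {0..r} majorant_product - (r + cmod (deriv \<phi> 0) / 2 * r\<^sup>2)) has_real_derivative y) (at x) \<and> 0 \<le> y"
      using majorant_product_ge[of x] x assms by (intro exI conjI) auto
  qed
  then show ?thesis by simp
qed

text \<open>Subordination of \<open>g / z\<close> to \<open>h / z\<close> and of \<open>\<phi> \<circ> \<omega>\<close> to \<open>\<phi>\<close> bounds the majorant of \<open>z * deriv f z\<close>, which
  is \<open>x\<close> times the derivative of the majorant of \<open>f\<close>.\<close>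
lemma starlike_conj_majorant_le:
  assumes f: "f \<in> starlike_conj \<phi>" and r: "0 \<le> r" "r \<le> 1/3"
  shows "majorant f r \<le> integral {0..r} majorant_product"
proof -
  have holf: "f holomorphic_on ball 0 1" using f by (simp add: starlike_conj_def class_A_def)
  obtain a where a: "normalized_expansion f a" using f by (auto simp: starlike_conj_def class_A_def)
  obtain g \<omega> w where \<omega>: "\<omega> holomorphic_on ball 0 1" "\<omega> 0 = 0" "\<omega> ` ball 0 1 \<subseteq> ball 0 1"
    and fg: "\<And>z. z \<in> ball 0 1 \<Longrightarrow> z * deriv f z = g z * \<phi> (\<omega> z)"
    and g: "g holomorphic_on ball 0 1"
    and w: "w holomorphic_on ball 0 1" "w 0 = 0" "\<And>z. z \<in> ball 0 1 \<Longrightarrow> cmod (w z) \<le> cmod z"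
    and gw: "\<And>z. z \<in> ball 0 1 \<Longrightarrow> g z = z * exp (k (w z))"
    by (rule starlike_conj_factorization[OF f]) (rule that; assumption)
  have wb: "w ` ball 0 1 \<subseteq> ball 0 1" using w(3) by fastforce
  have hol\<phi>\<omega>: "(\<lambda>z. \<phi> (\<omega> z)) holomorphic_on ball 0 1"
    by (rule holomorphic_on_compose_gen[OF \<omega>(1) \<phi>_holomorphic \<omega>(3), unfolded o_def])
  have holuw: "(\<lambda>z. u (w z)) holomorphic_on ball 0 1"
    by (rule holomorphic_on_compose_gen[OF w(1) holu wb, unfolded o_def])
  have bound: "majorant (\<lambda>z. z * deriv f z) x \<le> x * majorant_product x" if x: "0 \<le> x" "x \<le> 1/3" for x
  proof -
    have x1: "x < 1" using x by simp
    have "majorant (\<lambda>z. z * deriv f z) x = majorant (\<lambda>z. g z * \<phi> (\<omega> z)) x" by (rule majorant_cong) (rule fg)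
    also have "\<dots> \<le> majorant g x * majorant (\<lambda>z. \<phi> (\<omega> z)) x" by (rule majorant_mult_le[OF g hol\<phi>\<omega> x(1) x1])
    also have "majorant g x = majorant (\<lambda>z. z ^ 1 * u (w z)) x" by (rule majorant_cong) (simp add: gw u_def)
    also have "\<dots> = x * majorant (\<lambda>z. u (w z)) x" using majorant_times_z[OF holuw x(1) x1, of 1] by simp
    also have "x * majorant (\<lambda>z. u (w z)) x * majorant (\<lambda>z. \<phi> (\<omega> z)) x \<le> x * majorant u x * majorant \<phi> x"
      by (intro mult_mono mult_left_mono majorant_subordinate_le holu \<phi>_holomorphic \<omega> w(1,2) wb
            mult_nonneg_nonneg majorant_nonneg hol\<phi>\<omega> x x1)
    finally show ?thesis by (simp add: majorant_product_def mult.assoc)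
  qed
  have isC: "isCont (majorant f) x" if "0 \<le> x" "x \<le> r" for x
    using majorant_has_derivative[OF holf, of x] that r by (intro DERIV_isCont) auto
  have "integral {0..0} majorant_product - majorant f 0 \<le> integral {0..r} majorant_product - majorant f r"
  proof (rule DERIV_nonneg_imp_increasing_open[OF r(1), where f = "\<lambda>r. integral {0..r} majorant_product - majorant f r"])
    show "continuous_on {0..r} (\<lambda>r. integral {0..r} majorant_product - majorant f r)"
      by (intro continuous_intros continuous_integral_majorant_product continuous_at_imp_continuous_on)
         (use r isC in auto)
    fix x assume x: "0 < x" "x < r"
    define d where "d = (\<Sum>n. diffs (\<lambda>n. cmod (fps_nth (fps_expansion f 0) n)) n * x ^ n)"
    have "((\<lambda>r. integral {0..r} majorant_product - majorant f r) has_real_derivative majorant_product x - d) (at x)"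
      unfolding d_def
      by (intro DERIV_diff integral_majorant_product_derivative majorant_has_derivative holf) (use x r in auto)
    moreover have "x * d = majorant (\<lambda>z. z * deriv f z) x"
      unfolding d_def by (rule majorant_derivative_times[OF holf]) (use x r in auto)
    then have "x * d \<le> x * majorant_product x" using bound[of x] x r by simp
    then have "d \<le> majorant_product x" using x by simp
    ultimately show "\<exists>y. ((\<lambda>r. integral {0..r} majorant_product - majorant f r) has_real_derivative y) (at x) \<and> 0 \<le> y"
      by (intro exI[of _ "majorant_product x - d"]) auto
  qed
  moreover have "majorant f 0 = 0"
    using normalized_expansion_taylor(2)[OF a] by (simp add: majorant_def fps_expansion_def powser_zero)
  ultimately show ?thesis by simp
qed

text \<open>The quadratic lower bound for the integral tends to \<open>1 + \<bar>\<phi>'(0)\<bar> / 2 > 1 \<ge> L\<close> as \<open>r\<close> tends to \<open>1\<close>.\<close>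
lemma radius_exists:
  obtains \<rho> where "0 < \<rho>" "\<rho> < 1" "integral {0..\<rho>} majorant_product = L"
proof -
  define c where "c = cmod (deriv \<phi> 0)"
  have "c > 0" using d\<phi>0 by (simp add: c_def)
  have "((\<lambda>r::real. r + c / 2 * r\<^sup>2) \<longlongrightarrow> 1 + c / 2 * 1\<^sup>2) (at_left 1)" by (intro tendsto_intros)
  then have "\<forall>\<^sub>F r in at_left (1::real). 1 < r + c / 2 * r\<^sup>2"
    by (rule order_tendstoD) (use \<open>c > 0\<close> in simp)
  moreover have "\<forall>\<^sub>F r in at_left (1::real). r \<in> {0<..<1}" by (rule eventually_at_left_real) simp
  ultimately have "\<forall>\<^sub>F r in at_left (1::real). 1 < r + c / 2 * r\<^sup>2 \<and> r \<in> {0<..<1}" by (rule eventually_conj)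
  from eventually_happens[OF this] obtain b where b: "1 < b + c / 2 * b\<^sup>2" "0 < b" "b < 1" by auto
  have "L \<le> integral {0..b} majorant_product"
    using integral_majorant_product_lower[of b] b L_le_1 by (simp add: c_def)
  then obtain \<rho> where \<rho>: "0 \<le> \<rho>" "\<rho> \<le> b" "integral {0..\<rho>} majorant_product = L"
    using IVT'[of "\<lambda>r. integral {0..r} majorant_product" 0 L b] L_pos b continuous_integral_majorant_product[of b] by auto
  moreover have "\<rho> \<noteq> 0" using \<rho>(3) L_pos by auto
  ultimately show ?thesis using b by (intro that[of \<rho>]) auto
qed

end

theorem theorem2p9:
  fixes \<phi> h f :: "complex \<Rightarrow> complex" and a :: "nat \<Rightarrow> complex"
  assumes "ma_minda \<phi>"
    and "\<And>r::real. 0 < r \<Longrightarrow> r < 1 \<Longrightarrow>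
           complex_of_real (INF z\<in>sphere 0 r. cmod (\<phi> z)) = \<phi> (- complex_of_real r)"
    and "\<And>r::real. 0 < r \<Longrightarrow> r < 1 \<Longrightarrow>
           complex_of_real (SUP z\<in>sphere 0 r. cmod (\<phi> z)) = \<phi> (complex_of_real r)"
    and "h holomorphic_on unit_disc"
    and "\<And>z. z \<in> unit_disc - {0} \<Longrightarrow> h z \<noteq> 0 \<and> z * deriv h z / h z = \<phi> z"
    and "h 0 = 0" and "deriv h 0 - 1 = 0"
    and "f \<in> starlike_conj \<phi>"
    and "normalized_expansion f a"
  shows "\<exists>r\<^sub>f. smallest_positive_root
                  (\<lambda>r. complex_of_real (majorant_integral h \<phi> r) + value_at_minus_one h) r\<^sub>f \<and>
               (\<forall>z. cmod z \<le> min (1 / 3) r\<^sub>f \<longrightarrow>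
                  cmod z + (\<Sum>n. cmod (a (n + 2)) * cmod z ^ (n + 2))
                    \<le> infdist (f 0) (frontier (f ` unit_disc)))"
proof -
  interpret ma_minda_minimum \<phi> by unfold_locales (use assms(1,2) in auto)
  have heq: "h z = z * exp (k z)" if "z \<in> ball 0 1" for z
  proof (rule eq_times_exp_radial_primitive[OF assms(4) assms(6) _ _ k_holomorphic k_zero that])
    show "deriv h 0 = 1" using assms(7) by simp
    show "h x \<noteq> 0 \<and> x * deriv h x / h x = 1 + x * deriv k x" if "x \<in> ball 0 1 - {0}" for x
      using assms(5)[OF that] dk[of x] that by simp
  qed
  have val: "value_at_minus_one h = - of_real L" by (rule value_at_minus_one_eq[OF heq])
  obtain \<rho> where \<rho>: "0 < \<rho>" "\<rho> < 1" "integral {0..\<rho>} majorant_product = L" by (rule radius_exists)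
  have holf: "f holomorphic_on ball 0 1" using assms(8) by (simp add: starlike_conj_def class_A_def)
  show ?thesis
  proof (intro exI conjI allI impI)
    show "smallest_positive_root (\<lambda>r. complex_of_real (majorant_integral h \<phi> r) + value_at_minus_one h) \<rho>"
      unfolding smallest_positive_root_def
    proof (intro conjI allI impI)
      show "complex_of_real (majorant_integral h \<phi> \<rho>) + value_at_minus_one h = 0"
        using majorant_integral_eq[OF heq \<rho>(2)] \<rho>(3) val by simp
      fix t assume t: "0 < t \<and> t < \<rho>"
      then have "integral {0..t} majorant_product < L" using integral_majorant_product_less[of t \<rho>] \<rho> by simp
      then have "majorant_integral h \<phi> t \<noteq> L" using majorant_integral_eq[OF heq, of t] t \<rho> by simp
      then show "complex_of_real (majorant_integral h \<phi> t) + value_at_minus_one h \<noteq> 0" using val by simp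
    qed (use \<rho> in auto)
    fix z :: complex assume z: "cmod z \<le> min (1 / 3) \<rho>"
    define r where "r = cmod z"
    have r: "0 \<le> r" "r \<le> 1/3" "r \<le> \<rho>" "r < 1" using z by (auto simp: r_def)
    have nth: "fps_nth (fps_expansion f 0) n = (if n = 0 then 0 else if n = 1 then 1 else a n)" for n
      by (simp add: normalized_expansion_taylor(1)[OF assms(9)])
    have "majorant f r = (\<Sum>n. cmod (a (n + 2)) * r ^ (n + 2)) + (\<Sum>n<2. cmod (fps_nth (fps_expansion f 0) n) * r ^ n)"
      unfolding majorant_def suminf_split_initial_segment[OF summable_majorant[OF holf r(1) r(4)], of 2] by (simp add: nth)
    then have "r + (\<Sum>n. cmod (a (n + 2)) * r ^ (n + 2)) = majorant f r" by (simp add: nth numeral_2_eq_2)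
    also have "\<dots> \<le> integral {0..r} majorant_product" by (rule starlike_conj_majorant_le[OF assms(8) r(1,2)])
    also have "\<dots> \<le> integral {0..\<rho>} majorant_product"
      using integral_majorant_product_less[of r \<rho>] r \<rho> by (cases "r = \<rho>") auto
    also have "\<dots> \<le> infdist (f 0) (frontier (f ` ball 0 1))" using starlike_conj_distance[OF assms(8)] \<rho>(3) by simp
    finally show "cmod z + (\<Sum>n. cmod (a (n + 2)) * cmod z ^ (n + 2)) \<le> infdist (f 0) (frontier (f ` unit_disc))"
      by (simp add: r_def)
  qed
qed

end
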